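(* Let $\Omega\subset\mathbb{R}^N$ be an open, bounded and connected domain. Let $w_1,w_2\in W^{1,p(x)}(\Omega)$ be such that: (i) $w_1,w_2>0$ a.e. on $\Omega$; (ii) $\dfrac{w_1}{w_2},\dfrac{w_2}{w_1}\in L^{\infty}(\Omega)$; (iii) $\dfrac{\nabla w_1}{w_1},\dfrac{\nabla w_2}{w_2}\in L^1_{\mathrm{loc}}(\Omega)^N$. Then $\dfrac{w_2}{w_1},\dfrac{w_1}{w_2}\in W^{1,1}_{\mathrm{loc}}(\Omega)$ and moreover $$\nabla\left (\frac{w_2}{w_1} \right )=\frac{w_1\nabla w_2-w_2\nabla w_1}{w_1^2}=\frac{w_2}{w_1}\left (\frac{\nabla w_2}{w_2}-\frac{\nabla w_1}{w_1} \right )\quad\text{a.e. on }\Omega.$$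
   Context: $N\ge2$. $p:\overline\Omega\to(1,\infty)$ is either a log-Hölder continuous exponent with $p^-:=\min_{\overline\Omega}p\ge \frac{2N}{N+2}$, or a continuous exponent with $p^->\frac{2N}{N+2}$. $W^{1,p(x)}(\Omega)$ is the usual variable exponent Sobolev space; $\nabla$ denotes the weak gradient. *)

theory Defs
  imports "HOL-Analysis.Analysis"
begin

text \<open>Functions on \<open>\<Omega>\<close> are total functions on the ambient Euclidean space; every notion below that
  is relative to \<open>\<Omega>\<close> depends only on their values on \<open>\<Omega>\<close> (on \<open>closure \<Omega>\<close> for exponents).\<close>

primrec Ck :: "nat \<Rightarrow> ('a::euclidean_space \<Rightarrow> real) \<Rightarrow> bool" where
  "Ck 0 f \<longleftrightarrow> continuous_on UNIV f"
| "Ck (Suc k) f \<longleftrightarrow>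
     (\<forall>x. f differentiable (at x)) \<and> (\<forall>v. Ck k (\<lambda>x. frechet_derivative f (at x) v))"

definition test_functions :: "'a::euclidean_space set \<Rightarrow> ('a \<Rightarrow> real) set" where
  "test_functions \<Omega> =
     {\<phi>. (\<forall>k. Ck k \<phi>) \<and> compact (closure {x. \<phi> x \<noteq> 0}) \<and> closure {x. \<phi> x \<noteq> 0} \<subseteq> \<Omega>}"

definition L1_loc :: "'a::euclidean_space set \<Rightarrow> ('a \<Rightarrow> 'b::euclidean_space) set" where
  "L1_loc \<Omega> = {f. \<forall>K. compact K \<and> K \<subseteq> \<Omega> \<longrightarrow> set_integrable lebesgue K f}"

definition L_infinity :: "'a::euclidean_space set \<Rightarrow> ('a \<Rightarrow> real) set" where
  "L_infinity \<Omega> =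
     {f. set_borel_measurable lebesgue \<Omega> f \<and> (\<exists>C. AE x\<in>\<Omega> in lebesgue. \<bar>f x\<bar> \<le> C)}"

text \<open>A weak gradient is determined only up to null sets, so it is a relation between \<open>u\<close> and
  a representative \<open>g\<close>.\<close>

definition has_weak_gradient ::
  "'a::euclidean_space set \<Rightarrow> ('a \<Rightarrow> real) \<Rightarrow> ('a \<Rightarrow> 'a) \<Rightarrow> bool" where
  "has_weak_gradient \<Omega> u g \<longleftrightarrow> u \<in> L1_loc \<Omega> \<and> g \<in> L1_loc \<Omega> \<and>
     (\<forall>\<phi>\<in>test_functions \<Omega>. \<forall>b\<in>Basis.
        (LINT x:\<Omega>|lebesgue. u x * frechet_derivative \<phi> (at x) b) =
        - (LINT x:\<Omega>|lebesgue. (g x \<bullet> b) * \<phi> x))"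

definition W11_loc :: "'a::euclidean_space set \<Rightarrow> ('a \<Rightarrow> real) set" where
  "W11_loc \<Omega> = {u. \<exists>g. has_weak_gradient \<Omega> u g}"

text \<open>The scaling parameter \<open>l\<close> is that of the Luxemburg norm; for bounded exponents it may be
  taken to be \<open>1\<close>.\<close>

definition Lp_var ::
  "'a::euclidean_space set \<Rightarrow> ('a \<Rightarrow> real) \<Rightarrow> ('a \<Rightarrow> 'b::euclidean_space) set" where
  "Lp_var \<Omega> p = {f. set_borel_measurable lebesgue \<Omega> f \<and>
     (\<exists>l>0. set_integrable lebesgue \<Omega> (\<lambda>x. (norm (f x) / l) powr p x))}"

definition W1p_var :: "'a::euclidean_space set \<Rightarrow> ('a \<Rightarrow> real) \<Rightarrow> ('a \<Rightarrow> real) set" where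
  "W1p_var \<Omega> p = {u. u \<in> Lp_var \<Omega> p \<and> (\<exists>g. has_weak_gradient \<Omega> u g \<and> g \<in> Lp_var \<Omega> p)}"

text \<open>The restriction to \<open>dist x y < 1 / 2\<close> keeps \<open>- ln (dist x y)\<close> positive.\<close>

definition log_Holder_on :: "'a::euclidean_space set \<Rightarrow> ('a \<Rightarrow> real) \<Rightarrow> bool" where
  "log_Holder_on S p \<longleftrightarrow>
     (\<exists>C>0. \<forall>x\<in>S. \<forall>y\<in>S. 0 < dist x y \<and> dist x y < 1 / 2 \<longrightarrow>
        \<bar>p x - p y\<bar> \<le> C / (- ln (dist x y)))"

definition exponent_min :: "'a::euclidean_space set \<Rightarrow> ('a \<Rightarrow> real) \<Rightarrow> real" where
  "exponent_min \<Omega> p = Inf (p ` closure \<Omega>)"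

definition admissible_exponent :: "'a::euclidean_space set \<Rightarrow> ('a \<Rightarrow> real) \<Rightarrow> bool" where
  "admissible_exponent \<Omega> p \<longleftrightarrow> (\<forall>x\<in>closure \<Omega>. 1 < p x) \<and>
     (let N = real DIM('a) in
        (log_Holder_on (closure \<Omega>) p \<and> exponent_min \<Omega> p \<ge> 2 * N / (N + 2)) \<or>
        (continuous_on (closure \<Omega>) p \<and> exponent_min \<Omega> p > 2 * N / (N + 2)))"

end

theory Submission
  imports Defs
begin

text \<open>Let \<open>C\<close> bound \<open>w2 / w1\<close>. The inequalities \<open>0 \<le> w2 \<le> C * w1\<close> survive convolution with a nonnegative
  kernel at every point, so for \<open>e > 0\<close> the smooth quotients \<open>(w2 * \<rho> + e) / (w1 * \<rho> + e)\<close>, with \<open>*\<close> the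
  convolution, are bounded by \<open>C + 1\<close> and the classical quotient rule applies to them. Letting the
  kernel radius tend to 0 (the gradients converge in \<open>L\<^sup>1\<close>, their coefficients boundedly and almost
  everywhere) gives the quotient rule for \<open>(w2 + e) / (w1 + e)\<close>; then \<open>e\<close> tends to 0 by dominated
  convergence, the majorant being a multiple of \<open>\<bar>g1\<bar> / w1 + \<bar>g2\<bar> / w2\<close>. Uniqueness of the weak
  gradient also follows by mollification.\<close>

section \<open>A smooth compactly supported kernel\<close>

text \<open>The obstacle is that w1 has no positive lower bound, not even on compact sets, so
  gradients divided by w1 cannot be treated as bounded multiples of gradients. The shift by
  \<open>e\<close> repairs this: for fixed \<open>e\<close> every coefficient of a gradient is
  bounded by a constant times a power of 1 / \<open>e\<close>, and L1 convergence of the mollified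
  gradients suffices. The integrability of g1 / w1 and g2 / w2 says nothing about quotients of
  mollified functions, so it enters only once the kernel is gone. In the limit in \<open>e\<close>
  the delicate term is g2 / (w1 + e), whose numerator and denominator belong to different functions;
  it is controlled because \<bar>g2\<bar> / w1 = (w2 / w1) * \<bar>g2\<bar> / w2 \<le> C *
  \<bar>g2\<bar> / w2. To work on the whole space, all functions are cut off outside a compact
  neighbourhood \<open>K'\<close> of the support \<open>K\<close> of the test function. The cut may
  destroy the weak derivative near the boundary of \<open>K'\<close>, but for small kernel radii
  convolutions centred in \<open>K\<close> do not see it, and elsewhere the test function
  vanishes.\<close>

lemma Ck_SucD: "Ck (Suc k) f \<Longrightarrow> Ck k f"
proof (induction k arbitrary: f)
  case 0
  then show ?case
    by (simp add: continuous_at_imp_continuous_on differentiable_imp_continuous_within)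
next
  case (Suc k)
  then show ?case by (metis Ck.simps(2))
qed

lemma Ck_add: "Ck k f \<Longrightarrow> Ck k g \<Longrightarrow> Ck k (\<lambda>x. f x + g x)"
proof (induction k arbitrary: f g)
  case 0
  then show ?case by (simp add: continuous_on_add)
next
  case (Suc k)
  then have d: "f differentiable at x" "g differentiable at x" for x by auto
  have "frechet_derivative (\<lambda>x. f x + g x) (at x) =
      (\<lambda>v. frechet_derivative f (at x) v + frechet_derivative g (at x) v)" for x
    using d[unfolded frechet_derivative_works]
    by (intro frechet_derivative_at[symmetric] derivative_intros) auto
  then show ?case using Suc d by auto
qed

text \<open>The product rule leaves one factor undifferentiated in each term; \<open>Ck_SucD\<close>
  lowers its order so that the induction hypothesis applies.\<close>

lemma Ck_mult: "Ck k f \<Longrightarrow> Ck k g \<Longrightarrow> Ck k (\<lambda>x. f x * g x)"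
proof (induction k arbitrary: f g)
  case 0
  then show ?case by (simp add: continuous_on_mult)
next
  case (Suc k)
  then have d: "f differentiable at x" "g differentiable at x" for x by auto
  have "frechet_derivative (\<lambda>x. f x * g x) (at x) =
      (\<lambda>v. f x * frechet_derivative g (at x) v + frechet_derivative f (at x) v * g x)" for x
    using d[unfolded frechet_derivative_works]
    by (intro frechet_derivative_at[symmetric] derivative_intros) auto
  then show ?case using Suc d Ck_SucD[OF Suc.prems(1)] Ck_SucD[OF Suc.prems(2)]
    by (auto intro!: Ck_add)
qed

lemma Ck_const: "Ck k (\<lambda>x. c)"
  by (induction k arbitrary: c) simp_all

lemma Ck_inner: "Ck k (\<lambda>x. (x - a) \<bullet> v)"
proof (cases k)
  case (Suc n)
  have "((\<lambda>x. (x - a) \<bullet> v) has_derivative (\<lambda>h. h \<bullet> v)) (at x)" for x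
    by (auto intro!: derivative_eq_intros)
  then have "(\<lambda>x. (x - a) \<bullet> v) differentiable at x"
    "frechet_derivative (\<lambda>x. (x - a) \<bullet> v) (at x) = (\<lambda>h. h \<bullet> v)" for x
    by (auto simp: differentiable_def frechet_derivative_at[symmetric])
  then show ?thesis by (simp add: Suc Ck_const)
qed (auto intro!: continuous_intros)

text \<open>The index \<open>m\<close> makes the family closed under differentiation up to linear
  combinations, so that smoothness of exp (- 1 / t) follows by one induction over all
  \<open>m\<close> at once.\<close>

definition flat :: "nat \<Rightarrow> real \<Rightarrow> real" where
  "flat m t = (if t > 0 then exp (- 1 / t) / t ^ m else 0)"

text \<open>The substitution s = 1 / t turns the right-hand limit into the decay of s ^ m / exp s at
  infinity.\<close>

lemma tendsto_flat_0: "(flat m \<longlongrightarrow> 0) (at 0)"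
proof -
  have "((\<lambda>s::real. s ^ m / exp s) \<longlongrightarrow> 0) at_top"
    by (rule tendsto_power_div_exp_0)
  then have "((\<lambda>t. inverse t ^ m / exp (inverse t)) \<longlongrightarrow> (0::real)) (at_right 0)"
    by (rule filterlim_compose) (rule filterlim_inverse_at_top_right)
  then have R: "(flat m \<longlongrightarrow> 0) (at_right 0)"
    by (rule tendsto_cong[THEN iffD1, rotated])
      (auto simp: eventually_at_right_less eventually_at_filter flat_def exp_minus field_simps)
  have "(flat m \<longlongrightarrow> 0) (at_left 0)"
    by (rule tendsto_eventually) (auto simp: flat_def eventually_at_filter)
  with R show ?thesis by (simp add: filterlim_split_at)
qed

lemma has_real_derivative_flat:
  "(flat m has_real_derivative flat (m + 2) t - real m * flat (m + 1) t) (at t)"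
proof -
  consider "t > 0" | "t < 0" | "t = 0" by linarith
  then show ?thesis
  proof cases
    case 1
    have "((\<lambda>t. exp (- 1 / t) / t ^ m) has_real_derivative flat (m + 2) t - real m * flat (m + 1) t) (at t)"
      using 1
      apply (auto intro!: derivative_eq_intros simp: flat_def)
      apply (cases m)
       apply (auto simp: field_simps power2_eq_square)
      done
    then show ?thesis
      by (rule has_field_derivative_transform_within_open[where S="{0<..}"])
        (use 1 in \<open>auto simp: flat_def\<close>)
  next
    case 2
    have "((\<lambda>t. 0) has_real_derivative flat (m + 2) t - real m * flat (m + 1) t) (at t)"
      using 2 by (simp add: flat_def)
    then show ?thesis
      by (rule has_field_derivative_transform_within_open[where S="{..<0}"])
        (use 2 in \<open>auto simp: flat_def\<close>)
  next
    case 3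
    \<comment> \<open>Dividing by the argument raises the index by one, so the difference quotient
      at 0 is itself a member of the family and tends to 0.\<close>
    have "flat m y / y = flat (m + 1) y" "flat k 0 = 0" for y k
      by (simp_all add: flat_def)
    then show ?thesis
      using tendsto_flat_0[of "m + 1"] 3
      by (simp add: has_field_derivative_iff)
  qed
qed

text \<open>The derivative is written with sums and products only, so that \<open>Ck_add\<close> and
  \<open>Ck_mult\<close> apply to it as it stands.\<close>

lemma has_derivative_flat_ball:
  fixes a :: "'a::euclidean_space"
  shows "((\<lambda>x. flat m (s - (x - a) \<bullet> (x - a))) has_derivative
    (\<lambda>v. (flat (m + 2) (s - (x - a) \<bullet> (x - a)) + - real m * flat (m + 1) (s - (x - a) \<bullet> (x - a)))
      * (- 2 * ((x - a) \<bullet> v)))) (at x)"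
proof -
  have "((\<lambda>x. s - (x - a) \<bullet> (x - a)) has_derivative (\<lambda>v. - 2 * ((x - a) \<bullet> v))) (at x)"
    by (auto intro!: derivative_eq_intros simp: inner_commute)
  from has_derivative_compose[OF this has_real_derivative_flat[unfolded has_field_derivative_def]]
  show ?thesis by simp
qed

lemma Ck_flat_ball:
  fixes a :: "'a::euclidean_space"
  shows "Ck k (\<lambda>x. flat m (s - (x - a) \<bullet> (x - a)))"
proof (induction k arbitrary: m)
  case 0
  show ?case
    using has_derivative_flat_ball[of m s a]
    by (auto intro!: continuous_at_imp_continuous_on has_derivative_continuous)
next
  case (Suc k)
  have "(\<lambda>x. flat m (s - (x - a) \<bullet> (x - a))) differentiable at x" for x
    using has_derivative_flat_ball[of m s a] by (auto simp: differentiable_def)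
  then show ?case
    unfolding Ck.simps frechet_derivative_at[OF has_derivative_flat_ball, symmetric]
    by (intro conjI allI Ck_mult Ck_add Ck_const Ck_inner Suc) auto
qed

section \<open>Continuity of translations in \<open>L\<^sup>1\<close>\<close>

lemma
  fixes f :: "'a::euclidean_space \<Rightarrow> real"
  assumes "integrable lborel f"
  shows integrable_lborel_translate: "integrable lborel (\<lambda>x. f (x + h))"
    and integral_lborel_translate: "(\<integral>x. f (x + h) \<partial>lborel) = integral\<^sup>L lborel f"
proof -
  have "integrable (distr lborel borel ((+) h)) f"
    using assms by (simp add: lborel_distr_plus)
  from integrable_distr[OF _ this] integral_distr[of "(+) h" lborel borel f]
  show "integrable lborel (\<lambda>x. f (x + h))" "(\<integral>x. f (x + h) \<partial>lborel) = integral\<^sup>L lborel f"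
    using assms by (simp_all add: lborel_distr_plus add.commute[of _ h])
qed

text \<open>Sequences of shifts are used because dominated convergence is a statement about
  sequences.\<close>

definition L1_translation_continuous :: "('a::euclidean_space \<Rightarrow> real) \<Rightarrow> bool" where
  "L1_translation_continuous f \<longleftrightarrow>
     (\<forall>h. h \<longlonglongrightarrow> 0 \<longrightarrow> (\<lambda>n. \<integral>x. \<bar>f (x + h n) - f x\<bar> \<partial>lborel) \<longlonglongrightarrow> 0)"

text \<open>Translation is an isometry of L1, so the error of the approximation counts twice, once
  shifted and once not: an e / 3 argument.\<close>

lemma L1_translation_continuous_approx:
  fixes f :: "'a::euclidean_space \<Rightarrow> real"
  assumes f: "integrable lborel f"
    and approx: "\<And>e. e > 0 \<Longrightarrow> \<exists>g. integrable lborel g \<and> L1_translation_continuous g \<and>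
      (\<integral>x. \<bar>f x - g x\<bar> \<partial>lborel) < e"
  shows "L1_translation_continuous f"
  unfolding L1_translation_continuous_def
proof (intro allI impI LIMSEQ_I)
  fix h :: "nat \<Rightarrow> 'a" and e :: real
  assume h: "h \<longlonglongrightarrow> 0" and "e > 0"
  then obtain g where g: "integrable lborel g" "L1_translation_continuous g"
    "(\<integral>x. \<bar>f x - g x\<bar> \<partial>lborel) < e / 3"
    using approx[of "e / 3"] by auto
  have "(\<lambda>n. \<integral>x. \<bar>g (x + h n) - g x\<bar> \<partial>lborel) \<longlonglongrightarrow> 0"
    using g(2) h unfolding L1_translation_continuous_def by blast
  from order_tendstoD(2)[OF this, of "e / 3"]
  obtain n0 where n0: "\<And>n. n \<ge> n0 \<Longrightarrow> (\<integral>x. \<bar>g (x + h n) - g x\<bar> \<partial>lborel) < e / 3"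
    using \<open>e > 0\<close> by (auto simp: eventually_sequentially)
  have "norm ((\<integral>x. \<bar>f (x + h n) - f x\<bar> \<partial>lborel) - 0) < e" if "n \<ge> n0" for n
  proof -
    note [simp, intro] = f g(1) integrable_lborel_translate[OF f] integrable_lborel_translate[OF g(1)]
    have i: "integrable lborel (\<lambda>x. \<bar>f x - g x\<bar>)" by simp
    have "(\<integral>x. \<bar>f (x + h n) - f x\<bar> \<partial>lborel) \<le>
      (\<integral>x. \<bar>f (x + h n) - g (x + h n)\<bar> + \<bar>g (x + h n) - g x\<bar> + \<bar>f x - g x\<bar> \<partial>lborel)"
      by (intro integral_mono) auto
    also have "\<dots> = (\<integral>x. \<bar>f (x + h n) - g (x + h n)\<bar> \<partial>lborel) +
        (\<integral>x. \<bar>g (x + h n) - g x\<bar> \<partial>lborel) + (\<integral>x. \<bar>f x - g x\<bar> \<partial>lborel)"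
      by simp
    also have "(\<integral>x. \<bar>f (x + h n) - g (x + h n)\<bar> \<partial>lborel) = (\<integral>x. \<bar>f x - g x\<bar> \<partial>lborel)"
      using integral_lborel_translate[OF i] by simp
    finally show ?thesis using g(3) n0[OF that] by simp
  qed
  then show "\<exists>n0. \<forall>n\<ge>n0. norm ((\<integral>x. \<bar>f (x + h n) - f x\<bar> \<partial>lborel) - 0) < e"
    by blast
qed

lemma L1_translation_continuous_indicator_open:
  fixes U :: "'a::euclidean_space set"
  assumes "open U" and fin: "emeasure lborel U < \<infinity>"
  shows "L1_translation_continuous (indicator U)"
  unfolding L1_translation_continuous_def
proof (intro allI impI)
  fix h :: "nat \<Rightarrow> 'a"
  assume h: "h \<longlonglongrightarrow> 0"
  define u :: "'a \<Rightarrow> real" where "u = indicator U"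
  have [measurable]: "U \<in> sets borel" using \<open>open U\<close> by simp
  have u: "integrable lborel u" using fin unfolding u_def by (simp add: integrable_indicator_iff)
  note [simp] = u integrable_lborel_translate[OF u]
  \<comment> \<open>Both terms have the same integral, so it suffices to control the positive part of
    \<open>u x - u (x + h)\<close>, which tends to 0 pointwise because \<open>U\<close> is open.\<close>
  have eq: "(\<integral>x. \<bar>u (x + h n) - u x\<bar> \<partial>lborel) = 2 * (\<integral>x. max 0 (u x - u (x + h n)) \<partial>lborel)" for n
  proof -
    have "(\<integral>x. \<bar>u (x + h n) - u x\<bar> \<partial>lborel) =
      (\<integral>x. 2 * max 0 (u x - u (x + h n)) - u x + u (x + h n) \<partial>lborel)"
      by (intro Bochner_Integration.integral_cong) (auto simp: max_def)
    also have "\<dots> = 2 * (\<integral>x. max 0 (u x - u (x + h n)) \<partial>lborel)"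
      using integral_lborel_translate[OF u] by simp
    finally show ?thesis .
  qed
  have "(\<lambda>n. \<integral>x. max 0 (u x - u (x + h n)) \<partial>lborel) \<longlonglongrightarrow> (\<integral>(x::'a). 0 \<partial>lborel)"
  proof (rule integral_dominated_convergence[where w=u])
    show "AE x in lborel. (\<lambda>n. max 0 (u x - u (x + h n))) \<longlonglongrightarrow> 0"
    proof (rule AE_I2)
      fix x
      show "(\<lambda>n. max 0 (u x - u (x + h n))) \<longlonglongrightarrow> 0"
      proof (cases "x \<in> U")
        case True
        have "(\<lambda>n. x + h n) \<longlonglongrightarrow> x + 0" by (intro tendsto_intros h)
        then have "eventually (\<lambda>n. x + h n \<in> U) sequentially"
          using \<open>open U\<close> True by (simp add: topological_tendstoD)
        then show ?thesis
          by (intro tendsto_eventually) (auto elim!: eventually_mono simp: u_def True)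
      qed (simp add: u_def)
    qed
    show "integrable lborel u" by (rule u)
    show "AE x in lborel. norm (max 0 (u x - u (x + h n))) \<le> u x" for n
      by (rule AE_I2) (auto simp: u_def split: split_indicator)
  qed (auto simp: u_def)
  then show "(\<lambda>n. \<integral>x. \<bar>indicat_real U (x + h n) - indicat_real U x\<bar> \<partial>lborel) \<longlonglongrightarrow> 0"
    using eq tendsto_mult_left[of _ 0 sequentially 2] unfolding u_def by simp
qed

text \<open>Induction over integrable functions: indicators are reduced to those of open sets by
  outer regularity, sums use the triangle inequality, and limits use closedness under L1
  approximation.\<close>

lemma L1_translation_continuous_integrable:
  fixes f :: "'a::euclidean_space \<Rightarrow> real"
  assumes "integrable lborel f"
  shows "L1_translation_continuous f"
  using assms
proof (induction rule: integrable_induct)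
  case (base A c)
  then have [measurable]: "A \<in> sets borel" and fin: "emeasure lborel A < \<infinity>" by auto
  have iA: "integrable lborel (indicat_real A)"
    using fin by (simp add: integrable_indicator_iff)
  have "L1_translation_continuous (indicat_real A)"
  proof (rule L1_translation_continuous_approx)
    fix e :: real assume "e > 0"
    then obtain U where U: "open U" "A \<subseteq> U" "emeasure lborel (U - A) < e"
      using outer_regular_lborel[of A e] by auto
    have [measurable]: "U \<in> sets borel" using \<open>open U\<close> by simp
    \<comment> \<open>Finite measure of \<open>U\<close> is needed for its indicator to be
      integrable.\<close>
    have "emeasure lborel U = emeasure lborel A + emeasure lborel (U - A)"
      using U(2) by (subst plus_emeasure) (auto simp: Un_absorb1)
    then have finU: "emeasure lborel U < \<infinity>"
      using fin less_trans[OF U(3) ennreal_less_top] by simp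
    have "(\<integral>x. \<bar>indicat_real A x - indicat_real U x\<bar> \<partial>lborel) = (\<integral>x. indicat_real (U - A) x \<partial>lborel)"
      using U(2) by (intro Bochner_Integration.integral_cong) (auto split: split_indicator)
    also have "\<dots> = measure lborel (U - A)" by simp
    also have "\<dots> < e"
      using U(3) less_trans[OF U(3) ennreal_less_top]
      by (simp add: emeasure_eq_ennreal_measure ennreal_less_iff less_top)
    finally show "\<exists>g. integrable lborel g \<and> L1_translation_continuous g \<and>
        (\<integral>x. \<bar>indicat_real A x - g x\<bar> \<partial>lborel) < e"
      using L1_translation_continuous_indicator_open[OF U(1) finU] finU
      by (intro exI[of _ "indicat_real U"]) (simp add: integrable_indicator_iff)
  qed (rule iA)
  moreover have "\<bar>indicat_real A (x + h) *\<^sub>R c - indicat_real A x *\<^sub>R c\<bar> =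
      \<bar>indicat_real A (x + h) - indicat_real A x\<bar> * \<bar>c\<bar>" for x h
    by (metis abs_mult left_diff_distrib real_scaleR_def)
  ultimately show ?case
    unfolding L1_translation_continuous_def by (simp add: tendsto_mult_left_zero)
next
  case (add f g)
  show ?case
    unfolding L1_translation_continuous_def
  proof (intro allI impI)
    fix h :: "nat \<Rightarrow> 'a" assume h: "h \<longlonglongrightarrow> 0"
    note [simp] = add.hyps integrable_lborel_translate[OF add.hyps(1)] integrable_lborel_translate[OF add.hyps(2)]
    have "(\<lambda>n. (\<integral>x. \<bar>f (x + h n) - f x\<bar> \<partial>lborel) + (\<integral>x. \<bar>g (x + h n) - g x\<bar> \<partial>lborel)) \<longlonglongrightarrow> 0 + 0"
      using add h unfolding L1_translation_continuous_def by (intro tendsto_add) auto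
    then have "(\<lambda>n. (\<integral>x. \<bar>f (x + h n) - f x\<bar> + \<bar>g (x + h n) - g x\<bar> \<partial>lborel)) \<longlonglongrightarrow> 0"
      by simp
    then show "(\<lambda>n. \<integral>x. \<bar>f (x + h n) + g (x + h n) - (f x + g x)\<bar> \<partial>lborel) \<longlonglongrightarrow> 0"
    proof (rule Lim_null_comparison[rotated], intro always_eventually allI)
      fix n
      have "(\<integral>x. \<bar>f (x + h n) + g (x + h n) - (f x + g x)\<bar> \<partial>lborel) \<le>
        (\<integral>x. \<bar>f (x + h n) - f x\<bar> + \<bar>g (x + h n) - g x\<bar> \<partial>lborel)"
        by (intro integral_mono) auto
      then show "norm (\<integral>x. \<bar>f (x + h n) + g (x + h n) - (f x + g x)\<bar> \<partial>lborel) \<le>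
        (\<integral>x. \<bar>f (x + h n) - f x\<bar> + \<bar>g (x + h n) - g x\<bar> \<partial>lborel)"
        by simp
    qed
  qed
next
  case (lim f s)
  have f: "integrable lborel f" and s: "integrable lborel (s i)" "L1_translation_continuous (s i)" for i
    using lim by auto
  show ?case
  proof (rule L1_translation_continuous_approx)
    fix e :: real assume "e > 0"
    have "(\<lambda>n. \<integral>x. \<bar>f x - s n x\<bar> \<partial>lborel) \<longlonglongrightarrow> (\<integral>(x::'a). 0 \<partial>lborel)"
    \<comment> \<open>The induction rule supplies \<bar>s i x\<bar> \<le> 2 * \<bar>f x\<bar>,
      whence the factor 3.\<close>
    proof (rule integral_dominated_convergence[where w="\<lambda>x. 3 * \<bar>f x\<bar>"])
      show "AE x in lborel. (\<lambda>i. \<bar>f x - s i x\<bar>) \<longlonglongrightarrow> 0"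
      proof (rule AE_I2)
        fix x
        have "(\<lambda>i. s i x) \<longlonglongrightarrow> f x"
          using lim by simp
        then have "(\<lambda>i. \<bar>f x - s i x\<bar>) \<longlonglongrightarrow> \<bar>f x - f x\<bar>"
          by (intro tendsto_intros)
        then show "(\<lambda>i. \<bar>f x - s i x\<bar>) \<longlonglongrightarrow> 0" by simp
      qed
      show "AE x in lborel. norm \<bar>f x - s i x\<bar> \<le> 3 * \<bar>f x\<bar>" for i
      proof (rule AE_I2)
        fix x
        have "norm (s i x) \<le> 2 * norm (f x)"
          using lim by simp
        then show "norm \<bar>f x - s i x\<bar> \<le> 3 * \<bar>f x\<bar>"
          using abs_triangle_ineq4[of "f x" "s i x"] by simp
      qed
    qed (use f s(1) in simp_all)
    then have "eventually (\<lambda>n. (\<integral>x. \<bar>f x - s n x\<bar> \<partial>lborel) < e) sequentially"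
      using \<open>e > 0\<close> by (auto dest: order_tendstoD(2))
    then obtain n where "(\<integral>x. \<bar>f x - s n x\<bar> \<partial>lborel) < e"
      by (auto simp: eventually_sequentially)
    then show "\<exists>g. integrable lborel g \<and> L1_translation_continuous g \<and> (\<integral>x. \<bar>f x - g x\<bar> \<partial>lborel) < e"
      using s by blast
  qed (rule f)
qed

section \<open>Mollification\<close>

lemma integrable_lborel_bounded_compact_support:
  fixes f :: "'a::euclidean_space \<Rightarrow> real"
  assumes [measurable]: "f \<in> borel_measurable borel"
    and "\<And>x. \<bar>f x\<bar> \<le> B" and K: "compact K" "\<And>x. x \<notin> K \<Longrightarrow> f x = 0"
  shows "integrable lborel f"
proof (rule Bochner_Integration.integrable_bound)
  have "K \<in> sets borel" using K(1) by (simp add: compact_imp_closed)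
  then show "integrable lborel (\<lambda>x. indicat_real K x * B)"
    using emeasure_compact_finite[OF K(1)] by (intro integrable_mult_left) (simp add: integrable_indicator_iff)
  show "AE x in lborel. norm (f x) \<le> norm (indicat_real K x * B)"
    using assms(4) by (intro AE_I2) (auto split: split_indicator intro: order_trans[OF assms(2) abs_ge_self])
qed simp

lemma continuous_compact_support_bounded:
  fixes f :: "'a::euclidean_space \<Rightarrow> real"
  assumes "continuous_on UNIV f" "compact K" "\<And>x. x \<notin> K \<Longrightarrow> f x = 0"
  obtains B where "B \<ge> 0" "\<And>x. \<bar>f x\<bar> \<le> B"
proof -
  have "compact (f ` K)"
    using assms by (meson compact_continuous_image continuous_on_subset subset_UNIV)
  then obtain B where "\<forall>y\<in>f ` K. norm y \<le> B"
    using compact_imp_bounded bounded_iff by metis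
  with assms(3) show ?thesis
    by (intro that[of "max B 0"]) (auto, metis abs_zero imageI le_max_iff_disj order_refl)
qed

lemma integrable_mult_bounded:
  fixes f g :: "'a \<Rightarrow> real"
  assumes "integrable M f" and [measurable]: "g \<in> borel_measurable M" and "\<And>x. \<bar>g x\<bar> \<le> B"
  shows "integrable M (\<lambda>x. f x * g x)"
proof (rule Bochner_Integration.integrable_bound)
  show "integrable M (\<lambda>x. B * f x)" using assms by simp
  have "\<bar>f x\<bar> * \<bar>g x\<bar> \<le> \<bar>f x\<bar> * \<bar>B\<bar>" for x
    using assms(3)[of x] by (intro mult_left_mono) auto
  then show "AE x in M. norm (f x * g x) \<le> norm (B * f x)"
    by (auto simp: abs_mult mult.commute)
  show "(\<lambda>x. f x * g x) \<in> borel_measurable M" using assms(1) by measurable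
qed

section \<open>Differentiation under the integral sign\<close>

text \<open>The mean value inequality bounds the difference quotients by \<open>w\<close>. The bound
  is asked for \<bar>t\<bar> \<le> 1 only, so that for a compactly supported derivative a bounded
  \<open>w\<close> of compact support will do.\<close>

lemma has_real_derivative_integral_at_0:
  fixes F F' :: "real \<Rightarrow> 'a \<Rightarrow> real"
  assumes F: "\<And>t. integrable M (F t)"
    and F': "\<And>t x. ((\<lambda>t. F t x) has_real_derivative F' t x) (at t)"
    and bound: "\<And>t x. \<bar>t\<bar> \<le> 1 \<Longrightarrow> \<bar>F' t x\<bar> \<le> w x"
    and w: "integrable M w" and meas: "F' 0 \<in> borel_measurable M"
  shows "((\<lambda>t. \<integral>x. F t x \<partial>M) has_real_derivative (\<integral>x. F' 0 x \<partial>M)) (at 0)"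
proof -
  have "((\<lambda>t. ((\<integral>x. F t x \<partial>M) - (\<integral>x. F 0 x \<partial>M)) / t) \<longlongrightarrow> (\<integral>x. F' 0 x \<partial>M)) (at 0 within {-1..1})"
    unfolding tendsto_at_iff_sequentially comp_def
  proof (intro allI impI)
    fix X :: "nat \<Rightarrow> real"
    assume X: "\<forall>i. X i \<in> {-1..1} - {0}" "X \<longlonglongrightarrow> 0"
    have "(\<lambda>i. \<integral>x. (F (X i) x - F 0 x) / X i \<partial>M) \<longlonglongrightarrow> (\<integral>x. F' 0 x \<partial>M)"
    proof (rule integral_dominated_convergence[where w=w])
      show "AE x in M. (\<lambda>i. (F (X i) x - F 0 x) / X i) \<longlonglongrightarrow> F' 0 x"
      proof (rule AE_I2)
        fix x
        have "((\<lambda>t. (F t x - F 0 x) / t) \<longlongrightarrow> F' 0 x) (at 0)"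
          using F'[of x 0] by (simp add: has_field_derivative_iff)
        then show "(\<lambda>i. (F (X i) x - F 0 x) / X i) \<longlonglongrightarrow> F' 0 x"
          using X unfolding tendsto_at_iff_sequentially comp_def by auto
      qed
      show "AE x in M. norm ((F (X i) x - F 0 x) / X i) \<le> w x" for i
      proof (rule AE_I2)
        fix x
        have "norm (F (X i) x - F 0 x) \<le> w x * norm (X i - 0)"
          using X(1)
            by (intro field_differentiable_bound[of "{-1..1}" _ "\<lambda>t. F' t x"])
              (auto intro!: has_field_derivative_at_within[OF F'] bound)
        then show "norm ((F (X i) x - F 0 x) / X i) \<le> w x"
          using X(1) by (simp add: divide_le_eq)
      qed
    qed (use F w meas in auto)
    then show "(\<lambda>i. ((\<integral>x. F (X i) x \<partial>M) - (\<integral>x. F 0 x \<partial>M)) / X i) \<longlonglongrightarrow> (\<integral>x. F' 0 x \<partial>M)"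
      using F by simp
  qed
  moreover have "at (0::real) within {-1..1} = at 0"
    by (rule at_within_interior) simp
  ultimately show ?thesis
    by (simp add: has_field_derivative_iff)
qed

text \<open>The integral of \<open>f (x + t *\<^sub>R b)\<close> over x does not depend on t, by
  translation invariance; differentiating under the integral at t = 0 gives the claim.\<close>

lemma integral_directional_derivative_eq_0:
  fixes f :: "'a::euclidean_space \<Rightarrow> real"
  assumes f: "integrable lborel f" and [measurable]: "f' \<in> borel_measurable borel"
    and deriv: "\<And>x. ((\<lambda>t. f (x + t *\<^sub>R b)) has_real_derivative f' x) (at 0)"
    and bound: "\<And>x. \<bar>f' x\<bar> \<le> B" and K: "compact K" "\<And>x. x \<notin> K \<Longrightarrow> f' x = 0"
  shows "(\<integral>x. f' x \<partial>lborel) = 0"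
proof -
  have D: "((\<lambda>t. f (x + t *\<^sub>R b)) has_real_derivative f' (x + t *\<^sub>R b)) (at t)" for x t
    using deriv[of "x + t *\<^sub>R b"] DERIV_shift[of "\<lambda>s. f (x + s *\<^sub>R b)" _ 0 t]
    by (simp add: algebra_simps)
  \<comment> \<open>\<open>L\<close> is \<open>K\<close> swept along \<open>b\<close> for times in
    [-1, 1]: it contains every x with \<open>x + t *\<^sub>R b\<close> in \<open>K\<close> for some
    such t, so its indicator times \<open>B\<close> is a majorant.\<close>
  define L where "L = (\<lambda>(x, t). x + t *\<^sub>R b) ` (K \<times> {-1..1})"
  have L: "compact L"
    unfolding L_def using K(1) by (intro compact_continuous_image compact_Times)
      (auto intro!: continuous_intros simp: case_prod_unfold)
  then have [measurable]: "L \<in> sets borel" by (simp add: compact_imp_closed)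
  have "((\<lambda>t. \<integral>x. f (x + t *\<^sub>R b) \<partial>lborel) has_real_derivative (\<integral>x. f' (x + 0 *\<^sub>R b) \<partial>lborel)) (at 0)"
  proof (rule has_real_derivative_integral_at_0[where w="\<lambda>x. indicat_real L x * B"])
    show "\<bar>f' (x + t *\<^sub>R b)\<bar> \<le> indicat_real L x * B" if "\<bar>t\<bar> \<le> 1" for t x
    proof (cases "x \<in> L")
      case False
      have "x + t *\<^sub>R b \<notin> K"
      proof
        assume "x + t *\<^sub>R b \<in> K"
        moreover have "x = (x + t *\<^sub>R b) + (- t) *\<^sub>R b" by simp
        ultimately have "x \<in> L" unfolding L_def using that by (intro image_eqI[of _ _ "(x + t *\<^sub>R b, - t)"]) auto
        with False show False by simp
      qed
      then show ?thesis using K(2) False by simp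
    qed (simp add: bound)
    show "integrable lborel (\<lambda>x. indicat_real L x * B)"
      using emeasure_compact_finite[OF L] by (intro integrable_mult_left) (simp add: integrable_indicator_iff)
  qed (use f integrable_lborel_translate D in auto)
  moreover have "(\<lambda>t. \<integral>x. f (x + t *\<^sub>R b) \<partial>lborel) = (\<lambda>t. \<integral>x. f x \<partial>lborel)"
    using integral_lborel_translate[OF f] by simp
  ultimately show ?thesis
    using DERIV_unique[OF _ DERIV_const] by force
qed

section \<open>The normalized kernel\<close>

text \<open>The mass depends on the dimension, which neither \<open>r\<close> nor the real result
  determines; the type argument carries it.\<close>

definition kernel_mass :: "'a::euclidean_space itself \<Rightarrow> real \<Rightarrow> real" where
  "kernel_mass _ r = (\<integral>z. flat 0 (r\<^sup>2 - z \<bullet> (z::'a)) \<partial>lborel)"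

definition kernel :: "real \<Rightarrow> 'a::euclidean_space \<Rightarrow> real" where
  "kernel r z = flat 0 (r\<^sup>2 - z \<bullet> z) / kernel_mass TYPE('a) r"

text \<open>The derivative of \<open>kernel r\<close> at \<open>z\<close> in direction
  \<open>v\<close>: by the derivative rule for \<open>flat\<close> at index 0 only the
  \<open>flat 2\<close> term survives, times the derivative of
  \<open>r\<^sup>2 - z \<bullet> z\<close>.\<close>

definition kernel_deriv :: "real \<Rightarrow> 'a::euclidean_space \<Rightarrow> 'a \<Rightarrow> real" where
  "kernel_deriv r v z = flat 2 (r\<^sup>2 - z \<bullet> z) * (- 2 * (z \<bullet> v)) / kernel_mass TYPE('a) r"

lemma continuous_flat: "continuous_on S (flat m)"
  using has_real_derivative_flat by (meson DERIV_isCont continuous_at_imp_continuous_on)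

lemma continuous_flat_ball: "continuous_on UNIV (\<lambda>z::'a::euclidean_space. flat m (r\<^sup>2 - z \<bullet> z))"
  by (intro continuous_on_compose2[OF continuous_flat[of UNIV]] continuous_intros) auto

lemma flat_ball_outside:
  fixes z :: "'a::euclidean_space"
  assumes "r > 0" "z \<notin> ball 0 r"
  shows "flat m (r\<^sup>2 - z \<bullet> z) = 0"
proof -
  have "r\<^sup>2 \<le> z \<bullet> z"
    using assms unfolding power2_norm_eq_inner[symmetric] by (intro power_mono) auto
  then show ?thesis by (simp add: flat_def)
qed

lemma integrable_flat_ball:
  assumes "r > 0"
  shows "integrable lborel (\<lambda>z::'a::euclidean_space. flat m (r\<^sup>2 - z \<bullet> z))"
proof -
  have "compact (cball (0::'a) r)" "\<And>z::'a. z \<notin> cball 0 r \<Longrightarrow> flat m (r\<^sup>2 - z \<bullet> z) = 0"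
    using assms by (auto intro!: flat_ball_outside)
  from continuous_compact_support_bounded[OF continuous_flat_ball this]
    integrable_lborel_bounded_compact_support[OF borel_measurable_continuous_onI[OF continuous_flat_ball] _ this]
  show ?thesis by metis
qed

text \<open>A vanishing integral of the nonnegative integrand would make the ball, on which it is
  positive, a null set.\<close>

lemma kernel_mass_pos:
  assumes "r > 0"
  shows "kernel_mass TYPE('a::euclidean_space) r > 0"
proof -
  let ?f = "\<lambda>z::'a. flat 0 (r\<^sup>2 - z \<bullet> z)"
  have nn: "?f z \<ge> 0" for z by (simp add: flat_def)
  have "kernel_mass TYPE('a) r \<noteq> 0"
  proof
    assume "kernel_mass TYPE('a) r = 0"
    then have "AE z in lborel. ?f z = 0"
      using integral_nonneg_eq_0_iff_AE[OF integrable_flat_ball[OF assms]] nn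
      unfolding kernel_mass_def by auto
    then have "AE z in lborel. z \<notin> ball (0::'a) r"
    proof eventually_elim
      case (elim z)
      show ?case
      proof
        assume "z \<in> ball 0 r"
        then have "(norm z)\<^sup>2 < r\<^sup>2" by (intro power_strict_mono) auto
        then show False using elim by (simp add: flat_def power2_norm_eq_inner)
      qed
    qed
    then have "ball (0::'a) r \<in> null_sets lborel"
      by (subst (asm) AE_iff_null_sets[symmetric]) auto
    then show False
      using content_ball_pos[OF assms, of "0::'a"] by (auto simp: null_sets_def measure_def)
  qed
  moreover have "kernel_mass TYPE('a) r \<ge> 0"
    unfolding kernel_mass_def using nn by (intro integral_nonneg_AE) auto
  ultimately show ?thesis by simp
qed

lemma kernel_nonneg: "r > 0 \<Longrightarrow> kernel r (z::'a::euclidean_space) \<ge> 0"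
  using kernel_mass_pos[where 'a='a, of r] by (simp add: kernel_def flat_def)

lemma kernel_outside: "r > 0 \<Longrightarrow> z \<notin> ball 0 r \<Longrightarrow> kernel r z = 0"
  and kernel_deriv_outside: "r > 0 \<Longrightarrow> z \<notin> ball 0 r \<Longrightarrow> kernel_deriv r v z = 0"
  by (simp_all add: kernel_def kernel_deriv_def flat_ball_outside del: mem_ball)

lemma continuous_kernel: "continuous_on UNIV (kernel r)"
  unfolding kernel_def[abs_def] divide_inverse by (intro continuous_intros continuous_flat_ball)

lemma continuous_kernel_deriv: "continuous_on UNIV (kernel_deriv r v)"
  unfolding kernel_deriv_def[abs_def] divide_inverse by (intro continuous_intros continuous_flat_ball)

lemma measurable_kernel [measurable]:
  "kernel r \<in> borel_measurable borel" "kernel_deriv r v \<in> borel_measurable borel"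
  by (simp_all add: borel_measurable_continuous_onI continuous_kernel continuous_kernel_deriv)

lemma integrable_kernel: "r > 0 \<Longrightarrow> integrable lborel (kernel r :: 'a::euclidean_space \<Rightarrow> real)"
  unfolding kernel_def[abs_def] by (intro integrable_divide integrable_flat_ball)

lemma integral_kernel: "r > 0 \<Longrightarrow> (\<integral>z. kernel r (z::'a::euclidean_space) \<partial>lborel) = 1"
  using kernel_mass_pos[where 'a='a, of r] unfolding kernel_def[abs_def]
  by (simp add: kernel_mass_def)

lemma kernel_bounded:
  assumes "r > 0"
  obtains B where "B \<ge> 0" "\<And>z::'a::euclidean_space. \<bar>kernel r z\<bar> \<le> B"
  using assms
  by (rule_tac continuous_compact_support_bounded[OF continuous_kernel compact_cball[of "0::'a" r]])
    (auto intro!: kernel_outside)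

lemma kernel_deriv_bounded:
  assumes "r > 0"
  obtains B where "B \<ge> 0" "\<And>z::'a::euclidean_space. \<bar>kernel_deriv r v z\<bar> \<le> B"
  using assms
  by (rule_tac continuous_compact_support_bounded[OF continuous_kernel_deriv compact_cball[of "0::'a" r]])
    (auto intro!: kernel_deriv_outside)

lemma has_derivative_kernel:
  fixes x y :: "'a::euclidean_space"
  shows "((\<lambda>y. kernel r (y - x)) has_derivative (\<lambda>v. kernel_deriv r v (y - x))) (at y)"
  unfolding kernel_def kernel_deriv_def divide_inverse
  by (rule has_derivative_eq_rhs, rule has_derivative_mult_left, rule has_derivative_flat_ball) (simp add: numeral_2_eq_2)

text \<open>Testing with translates of the kernel is what turns the definition of a weak gradient
  into an identity for convolutions.\<close>

lemma kernel_in_test_functions: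
  fixes x :: "'a::euclidean_space"
  assumes "r > 0" "cball x r \<subseteq> \<Omega>"
  shows "(\<lambda>y. kernel r (y - x)) \<in> test_functions \<Omega>"
proof -
  have "Ck k (\<lambda>y. kernel r (y - x))" for k
    unfolding kernel_def divide_inverse by (intro Ck_mult Ck_flat_ball Ck_const)
  moreover have "{y. kernel r (y - x) \<noteq> 0} \<subseteq> cball x r"
  proof
    fix y assume "y \<in> {y. kernel r (y - x) \<noteq> 0}"
    then have "y - x \<in> ball 0 r" using kernel_outside[OF assms(1), of "y - x"] by blast
    then show "y \<in> cball x r" by (simp add: dist_norm norm_minus_commute)
  qed
  then have "closure {y. kernel r (y - x) \<noteq> 0} \<subseteq> cball x r"
    by (intro closure_minimal) auto
  ultimately show ?thesis
    using assms(2) unfolding test_functions_def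
    by (auto intro: compact_closure[THEN iffD2] bounded_subset[OF bounded_cball closure_subset[THEN order_trans]])
qed

section \<open>Convolution with the kernel\<close>

text \<open>The kernel is even, so this is the usual convolution; with \<open>y - x\<close> the
  kernel appears literally as a test function in y.\<close>

definition mollify :: "real \<Rightarrow> ('a::euclidean_space \<Rightarrow> real) \<Rightarrow> 'a \<Rightarrow> real" where
  "mollify r f x = (\<integral>y. f y * kernel r (y - x) \<partial>lborel)"

lemma measurable_mollify [measurable]:
  assumes [measurable]: "f \<in> borel_measurable borel"
  shows "mollify r f \<in> borel_measurable borel"
  unfolding mollify_def[abs_def] by measurable

lemma integrable_mult_kernel:
  assumes "r > 0" "integrable lborel f"
  shows "integrable lborel (\<lambda>y. f y * kernel r (y - x))"
proof -
  obtain B where "\<And>z::'a. \<bar>kernel r z\<bar> \<le> B"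
    using kernel_bounded[OF assms(1)] by blast
  then show ?thesis
    using assms by (intro integrable_mult_bounded[where B=B]) auto
qed

lemma integrable_mult_kernel_deriv:
  assumes "r > 0" "integrable lborel f"
  shows "integrable lborel (\<lambda>y. f y * kernel_deriv r v (y - x))"
proof -
  obtain B where "\<And>z::'a. \<bar>kernel_deriv r v z\<bar> \<le> B"
    using kernel_deriv_bounded[OF assms(1)] by blast
  then show ?thesis
    using assms by (intro integrable_mult_bounded[where B=B]) auto
qed

text \<open>An almost everywhere inequality becomes one at every point, which later keeps the
  regularized denominators positive everywhere.\<close>

lemma mollify_mono:
  assumes "r > 0" "integrable lborel f" "integrable lborel g" "AE x in lborel. f x \<le> g x"
  shows "mollify r f x \<le> mollify r g x"
  unfolding mollify_def
  using assms(4)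
  by (intro integral_mono_AE integrable_mult_kernel assms)
    (auto elim!: eventually_mono intro!: mult_right_mono kernel_nonneg assms)

lemma mollify_cmult: "mollify r (\<lambda>x. c * f x) x = c * mollify r f x"
  unfolding mollify_def by (simp add: mult.assoc)

lemma kernel_deriv_scale: "kernel_deriv r (c *\<^sub>R v) z = c * kernel_deriv r v z"
  by (simp add: kernel_deriv_def)

text \<open>The derivative falls on the kernel, so integrability of \<open>f\<close> is enough; the
  sign comes from x entering through \<open>y - x\<close>.\<close>

lemma has_real_derivative_mollify:
  fixes f :: "'a::euclidean_space \<Rightarrow> real"
  assumes "r > 0" and f: "integrable lborel f"
  shows "((\<lambda>t. mollify r f (x + t *\<^sub>R b)) has_real_derivative
    - (\<integral>y. f y * kernel_deriv r b (y - x) \<partial>lborel)) (at 0)"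
proof -
  obtain B where B: "B \<ge> 0" "\<And>z::'a. \<bar>kernel_deriv r b z\<bar> \<le> B"
    using kernel_deriv_bounded[OF assms(1)] by blast
  have "((\<lambda>t. \<integral>y. f y * kernel r (y - (x + t *\<^sub>R b)) \<partial>lborel) has_real_derivative
    (\<integral>y. f y * - kernel_deriv r b (y - (x + 0 *\<^sub>R b)) \<partial>lborel)) (at 0)"
  proof (rule has_real_derivative_integral_at_0)
    show "((\<lambda>t. f y * kernel r (y - (x + t *\<^sub>R b))) has_real_derivative
        f y * - kernel_deriv r b (y - (x + t *\<^sub>R b))) (at t)" for t y
    proof -
      have "((\<lambda>t. y - x - t *\<^sub>R b) has_derivative (\<lambda>h. - h *\<^sub>R b)) (at t)"
        by (auto intro!: derivative_eq_intros)
      from has_derivative_compose[OF this has_derivative_kernel[of r 0]]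
      have "((\<lambda>t. kernel r (y - (x + t *\<^sub>R b))) has_derivative
          (\<lambda>h. kernel_deriv r (- h *\<^sub>R b) (y - (x + t *\<^sub>R b)))) (at t)"
        by (simp add: diff_diff_eq)
      then have "((\<lambda>t. kernel r (y - (x + t *\<^sub>R b))) has_real_derivative
          - kernel_deriv r b (y - (x + t *\<^sub>R b))) (at t)"
        unfolding has_field_derivative_def
        by (rule has_derivative_eq_rhs) (simp add: kernel_deriv_scale fun_eq_iff del: scaleR_minus_left)
      then show ?thesis by (rule DERIV_cmult)
    qed
    show "\<bar>f y * - kernel_deriv r b (y - (x + t *\<^sub>R b))\<bar> \<le> \<bar>f y\<bar> * B" for t y
      using B by (simp add: abs_mult mult_left_mono)
    show "(\<lambda>y. f y * - kernel_deriv r b (y - (x + 0 *\<^sub>R b))) \<in> borel_measurable lborel"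
      using f by simp
  qed (use f in \<open>simp_all add: integrable_mult_kernel assms\<close>)
  then show ?thesis
    by (simp add: mollify_def)
qed

lemma integral_mult_kernel_deriv_bounded:
  fixes f :: "'a::euclidean_space \<Rightarrow> real"
  assumes "r > 0" and f: "integrable lborel f"
  obtains B where "\<And>x. \<bar>\<integral>y. f y * kernel_deriv r b (y - x) \<partial>lborel\<bar> \<le> B"
proof -
  obtain B where B: "B \<ge> 0" "\<And>z::'a. \<bar>kernel_deriv r b z\<bar> \<le> B"
    using kernel_deriv_bounded[OF assms(1)] by blast
  have "\<bar>\<integral>y. f y * kernel_deriv r b (y - x) \<partial>lborel\<bar> \<le> (\<integral>y. \<bar>f y\<bar> * B \<partial>lborel)" for x
  proof -
    have "\<bar>\<integral>y. f y * kernel_deriv r b (y - x) \<partial>lborel\<bar> \<le> (\<integral>y. \<bar>f y * kernel_deriv r b (y - x)\<bar> \<partial>lborel)"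
      by (rule integral_abs_bound)
    also have "\<dots> \<le> (\<integral>y. \<bar>f y\<bar> * B \<partial>lborel)"
      using f B by (intro integral_mono integrable_abs integrable_mult_kernel_deriv assms)
        (auto simp: abs_mult intro!: mult_left_mono)
    finally show ?thesis .
  qed
  then show ?thesis by (rule that)
qed

lemma mollify_translate:
  fixes f :: "'a::euclidean_space \<Rightarrow> real"
  assumes "r > 0" "integrable lborel f"
  shows "mollify r f x = (\<integral>z. f (x + z) * kernel r z \<partial>lborel)"
  using integral_lborel_translate[OF integrable_mult_kernel[OF assms, of x], of x]
  by (simp add: mollify_def add.commute)

text \<open>Since the kernel has mass 1, the difference is a weighted average of f (x + z) - f x
  over small z, and exchanging the integrals leaves an average of quantities bounded by
  \<open>e\<close>. Nonnegative integrals are used because this estimate also serves to prove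
  integrability of the mollification.\<close>

lemma nn_integral_mollify_diff:
  fixes f :: "'a::euclidean_space \<Rightarrow> real"
  assumes "r > 0" and f: "integrable lborel f"
    and e: "\<And>z. norm z < r \<Longrightarrow> (\<integral>x. \<bar>f (x + z) - f x\<bar> \<partial>lborel) \<le> e" and "e \<ge> 0"
  shows "(\<integral>\<^sup>+x. \<bar>mollify r f x - f x\<bar> \<partial>lborel) \<le> ennreal e"
proof -
  have [measurable]: "f \<in> borel_measurable borel" using f by simp
  have "(\<integral>\<^sup>+x. \<bar>mollify r f x - f x\<bar> \<partial>lborel) \<le>
    (\<integral>\<^sup>+x. (\<integral>\<^sup>+z. ennreal (\<bar>f (x + z) - f x\<bar> * kernel r z) \<partial>lborel) \<partial>lborel)"
  proof (rule nn_integral_mono)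
    fix x
    have i: "integrable lborel (\<lambda>z. f (x + z) * kernel r z)"
      using integrable_lborel_translate[OF integrable_mult_kernel[OF assms(1,2), of x], of x]
      by (simp add: add.commute)
    have j: "integrable lborel (\<lambda>z::'a. f x * kernel r z)"
      using integrable_kernel[where 'a='a, OF assms(1)] by simp
    have "mollify r f x - f x = (\<integral>z. f (x + z) * kernel r z - f x * kernel r z \<partial>lborel)"
      using i j integral_kernel[where 'a='a, OF assms(1)] by (simp add: mollify_translate[OF assms(1,2)])
    also have "\<dots> = (\<integral>z. (f (x + z) - f x) * kernel r z \<partial>lborel)"
      by (simp add: left_diff_distrib)
    finally have eq: "mollify r f x - f x = (\<integral>z. (f (x + z) - f x) * kernel r z \<partial>lborel)" .
    have "ennreal (norm (\<integral>z. (f (x + z) - f x) * kernel r z \<partial>lborel)) \<le>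
        (\<integral>\<^sup>+z. norm ((f (x + z) - f x) * kernel r z) \<partial>lborel)"
      using i j by (intro integral_norm_bound_ennreal) (simp add: left_diff_distrib)
    then show "ennreal \<bar>mollify r f x - f x\<bar> \<le> (\<integral>\<^sup>+z. ennreal (\<bar>f (x + z) - f x\<bar> * kernel r z) \<partial>lborel)"
      unfolding eq by (simp add: abs_mult kernel_nonneg[OF assms(1)])
  qed
  also have "\<dots> = (\<integral>\<^sup>+z. (\<integral>\<^sup>+x. ennreal (\<bar>f (x + z) - f x\<bar> * kernel r z) \<partial>lborel) \<partial>lborel)"
    by (rule lborel_pair.Fubini') measurable
  also have "\<dots> \<le> (\<integral>\<^sup>+z. ennreal (e * kernel r (z::'a)) \<partial>lborel)"
  proof (rule nn_integral_mono)
    fix z :: 'a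
    show "(\<integral>\<^sup>+x. ennreal (\<bar>f (x + z) - f x\<bar> * kernel r z) \<partial>lborel) \<le> ennreal (e * kernel r z)"
    proof (cases "norm z < r")
      case True
      have "integrable lborel (\<lambda>x. \<bar>f (x + z) - f x\<bar>)"
        using f integrable_lborel_translate[OF f] by simp
      then have "(\<integral>\<^sup>+x. ennreal (\<bar>f (x + z) - f x\<bar> * kernel r z) \<partial>lborel) =
          ennreal (\<integral>x. \<bar>f (x + z) - f x\<bar> * kernel r z \<partial>lborel)"
        by (intro nn_integral_eq_integral) (auto simp: kernel_nonneg[OF assms(1)])
      also have "\<dots> \<le> ennreal (e * kernel r z)"
        using e[OF True] by (auto intro!: ennreal_leI mult_right_mono simp: kernel_nonneg[OF assms(1)])
      finally show ?thesis .
    qed (simp add: kernel_outside[OF assms(1)])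
  qed
  also have "\<dots> = ennreal (\<integral>z. e * kernel r (z::'a) \<partial>lborel)"
    using integrable_kernel[where 'a='a, OF assms(1)] \<open>e \<ge> 0\<close>
    by (intro nn_integral_eq_integral) (auto simp: kernel_nonneg[OF assms(1)])
  also have "\<dots> = ennreal e"
    by (simp add: integral_kernel[where 'a='a, OF assms(1)])
  finally show ?thesis .
qed

text \<open>The previous estimate with the crude bound 2 * \<integral>\<bar>f\<bar>, valid for every
  shift.\<close>

lemma integrable_mollify:
  fixes f :: "'a::euclidean_space \<Rightarrow> real"
  assumes "r > 0" and f: "integrable lborel f"
  shows "integrable lborel (mollify r f)"
proof -
  have "integrable lborel (\<lambda>x. mollify r f x - f x)"
  proof (rule integrableI_bounded)
    have "(\<integral>\<^sup>+x. \<bar>mollify r f x - f x\<bar> \<partial>lborel) \<le> ennreal (2 * (\<integral>x. \<bar>f x\<bar> \<partial>lborel))"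
    proof (rule nn_integral_mollify_diff[OF assms])
      fix z :: 'a
      have "(\<integral>x. \<bar>f (x + z) - f x\<bar> \<partial>lborel) \<le> (\<integral>x. \<bar>f (x + z)\<bar> + \<bar>f x\<bar> \<partial>lborel)"
        using f integrable_lborel_translate[OF f] by (intro integral_mono) auto
      also have "\<dots> = 2 * (\<integral>x. \<bar>f x\<bar> \<partial>lborel)"
        using f integrable_lborel_translate[OF f] integral_lborel_translate[of "\<lambda>x. \<bar>f x\<bar>" z] by simp
      finally show "(\<integral>x. \<bar>f (x + z) - f x\<bar> \<partial>lborel) \<le> 2 * (\<integral>x. \<bar>f x\<bar> \<partial>lborel)" .
    qed simp
    then show "(\<integral>\<^sup>+x. ennreal (norm (mollify r f x - f x)) \<partial>lborel) < \<infinity>"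
      by (auto simp: less_top[symmetric] top_unique)
  qed (use f in simp)
  from Bochner_Integration.integrable_add[OF this f] show ?thesis by simp
qed

lemma mollify_tendsto_L1:
  fixes f :: "'a::euclidean_space \<Rightarrow> real"
  assumes f: "integrable lborel f" and r: "\<And>n. r n > 0" "r \<longlonglongrightarrow> 0"
  shows "(\<lambda>n. \<integral>x. \<bar>mollify (r n) f x - f x\<bar> \<partial>lborel) \<longlonglongrightarrow> 0"
proof (rule LIMSEQ_I)
  fix e :: real assume "e > 0"
  \<comment> \<open>From sequential to epsilon-delta continuity: otherwise shifts shorter than 1 /
    (n + 1) would violate \<open>L1_translation_continuous\<close>.\<close>
  have "\<exists>d>0. \<forall>z. norm z < d \<longrightarrow> (\<integral>x. \<bar>f (x + z) - f x\<bar> \<partial>lborel) \<le> e / 2"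
  proof (rule ccontr)
    assume "\<not> ?thesis"
    then have "\<forall>n::nat. \<exists>z. norm z < inverse (real (Suc n)) \<and> (\<integral>x. \<bar>f (x + z) - f x\<bar> \<partial>lborel) > e / 2"
      by (meson inverse_positive_iff_positive not_le of_nat_0_less_iff zero_less_Suc)
    then obtain h where h: "\<And>n. norm (h n) < inverse (real (Suc n))"
      "\<And>n. (\<integral>x. \<bar>f (x + h n) - f x\<bar> \<partial>lborel) > e / 2"
      by metis
    have "h \<longlonglongrightarrow> 0"
      using h(1) by (intro Lim_null_comparison[OF _ LIMSEQ_inverse_real_of_nat]) (intro always_eventually allI less_imp_le)
    then have "(\<lambda>n. \<integral>x. \<bar>f (x + h n) - f x\<bar> \<partial>lborel) \<longlonglongrightarrow> 0"
      using L1_translation_continuous_integrable[OF f] unfolding L1_translation_continuous_def by blast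
    from order_tendstoD(2)[OF this, of "e / 2"] \<open>e > 0\<close> obtain n where
      "(\<integral>x. \<bar>f (x + h n) - f x\<bar> \<partial>lborel) < e / 2"
      by (auto simp: eventually_sequentially)
    with h(2)[of n] show False by simp
  qed
  then obtain d where d: "d > 0" "\<And>z. norm z < d \<Longrightarrow> (\<integral>x. \<bar>f (x + z) - f x\<bar> \<partial>lborel) \<le> e / 2"
    by blast
  from order_tendstoD(2)[OF r(2) d(1)] obtain n0 where n0: "\<And>n. n \<ge> n0 \<Longrightarrow> r n < d"
    by (auto simp: eventually_sequentially)
  have "norm ((\<integral>x. \<bar>mollify (r n) f x - f x\<bar> \<partial>lborel) - 0) < e" if "n \<ge> n0" for n
  proof -
    have "ennreal (\<integral>x. \<bar>mollify (r n) f x - f x\<bar> \<partial>lborel) = (\<integral>\<^sup>+x. \<bar>mollify (r n) f x - f x\<bar> \<partial>lborel)"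
      using f integrable_mollify[OF r(1) f] by (intro nn_integral_eq_integral[symmetric]) auto
    also have "\<dots> \<le> ennreal (e / 2)"
      using n0[OF that] d(2) \<open>e > 0\<close> by (intro nn_integral_mollify_diff r f) auto
    finally show ?thesis using \<open>e > 0\<close> by (simp add: ennreal_le_iff)
  qed
  then show "\<exists>n0. \<forall>n\<ge>n0. norm ((\<integral>x. \<bar>mollify (r n) f x - f x\<bar> \<partial>lborel) - 0) < e"
    by blast
qed

text \<open>Split \<open>H n * A n\<close> as \<open>(H n - h) * A n + h * A n\<close>: the first
  part is at most \<open>B\<close> times the L1 distance, the second is dominated by
  \<open>B\<close> times \<bar>h\<bar>.\<close>

lemma tendsto_integral_mult:
  fixes A H :: "nat \<Rightarrow> 'a \<Rightarrow> real" and h :: "'a \<Rightarrow> real"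
  assumes meas [measurable]: "\<And>n. A n \<in> borel_measurable M" "a \<in> borel_measurable M"
    and bound: "\<And>n x. \<bar>A n x\<bar> \<le> B" and lim: "AE x in M. (\<lambda>n. A n x) \<longlonglongrightarrow> a x"
    and H: "\<And>n. integrable M (H n)" "integrable M h" "(\<lambda>n. \<integral>x. \<bar>H n x - h x\<bar> \<partial>M) \<longlonglongrightarrow> 0"
  shows "(\<lambda>n. \<integral>x. H n x * A n x \<partial>M) \<longlonglongrightarrow> (\<integral>x. h x * a x \<partial>M)"
proof -
  have i: "integrable M (\<lambda>x. H n x * A n x)" "integrable M (\<lambda>x. h x * A n x)"
    "integrable M (\<lambda>x. (H n x - h x) * A n x)" for n
    using H bound by (auto intro!: integrable_mult_bounded[where B=B])
  have 1: "(\<lambda>n. \<integral>x. h x * A n x \<partial>M) \<longlonglongrightarrow> (\<integral>x. h x * a x \<partial>M)"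
  proof (rule integral_dominated_convergence[where w="\<lambda>x. \<bar>h x\<bar> * B"])
    show "AE x in M. (\<lambda>n. h x * A n x) \<longlonglongrightarrow> h x * a x"
      using lim by eventually_elim (intro tendsto_intros)
    show "AE x in M. norm (h x * A n x) \<le> \<bar>h x\<bar> * B" for n
      using bound by (auto simp: abs_mult intro!: mult_left_mono)
  qed (use H in auto)
  have 2: "(\<lambda>n. \<integral>x. (H n x - h x) * A n x \<partial>M) \<longlonglongrightarrow> 0"
  proof (rule Lim_null_comparison)
    show "(\<lambda>n. (\<integral>x. \<bar>H n x - h x\<bar> \<partial>M) * B) \<longlonglongrightarrow> 0"
      using tendsto_mult_right[OF H(3), of B] by simp
    have "\<bar>\<integral>x. (H n x - h x) * A n x \<partial>M\<bar> \<le> (\<integral>x. \<bar>H n x - h x\<bar> \<partial>M) * B" for n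
    proof -
      have "\<bar>\<integral>x. (H n x - h x) * A n x \<partial>M\<bar> \<le> (\<integral>x. \<bar>(H n x - h x) * A n x\<bar> \<partial>M)"
        by (rule integral_abs_bound)
      also have "\<dots> \<le> (\<integral>x. \<bar>H n x - h x\<bar> * B \<partial>M)"
        using H bound i by (intro integral_mono integrable_abs)
          (auto simp: abs_mult intro!: mult_left_mono)
      finally show ?thesis by simp
    qed
    then show "\<forall>\<^sub>F n in sequentially. norm (\<integral>x. (H n x - h x) * A n x \<partial>M) \<le> (\<integral>x. \<bar>H n x - h x\<bar> \<partial>M) * B"
      by simp
  qed
  have "(\<integral>x. H n x * A n x \<partial>M) = (\<integral>x. (H n x - h x) * A n x \<partial>M) + (\<integral>x. h x * A n x \<partial>M)" for n
  proof -
    have "(\<integral>x. H n x * A n x \<partial>M) = (\<integral>x. (H n x - h x) * A n x + h x * A n x \<partial>M)"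
      by (simp add: algebra_simps)
    then show ?thesis using i by simp
  qed
  then show ?thesis
    using tendsto_add[OF 2 1] by simp
qed

section \<open>The quotient rule for regularized quotients\<close>

text \<open>Indeed b + e \<le> C * a + e \<le> (C + 1) * (a + e). The bound is independent of
  \<open>e\<close>, as the later limit requires.\<close>

lemma regularized_quotient_le:
  fixes a b :: real
  assumes "0 \<le> a" "0 \<le> b" "b \<le> C * a" "e > 0" "C \<ge> 0"
  shows "\<bar>(b + e) / (a + e)\<bar> \<le> C + 1"
proof -
  have "0 \<le> C * e" using assms by simp
  then have "b + e \<le> (C + 1) * (a + e)"
    using assms(1,3) unfolding distrib_left distrib_right by linarith
  then show ?thesis
    using assms by (simp add: pos_divide_le_eq)
qed

text \<open>The three integrals add up to the integral of the directional derivative of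
  \<open>\<phi> x * u x\<close>, which vanishes. The integration by parts identities are required on
  \<open>K\<close> only, since \<open>\<phi>\<close> and \<open>\<phi>'\<close> vanish
  elsewhere.\<close>

lemma integral_regularized_mollified_quotient:
  fixes W1 W2 H1 H2 :: "'a::euclidean_space \<Rightarrow> real"
  assumes int: "integrable lborel W1" "integrable lborel W2" "integrable lborel H1" "integrable lborel H2"
    and sgn: "AE x in lborel. 0 \<le> W1 x" "AE x in lborel. 0 \<le> W2 x" "AE x in lborel. W2 x \<le> C * W1 x"
    and "C \<ge> 0" "e > 0" "r > 0"
    and phi: "continuous_on UNIV \<phi>" "continuous_on UNIV \<phi>'"
      "\<And>x. ((\<lambda>t. \<phi> (x + t *\<^sub>R b)) has_real_derivative \<phi>' x) (at 0)"
    and K: "compact K" "\<And>x. x \<notin> K \<Longrightarrow> \<phi> x = 0" "\<And>x. x \<notin> K \<Longrightarrow> \<phi>' x = 0"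
    and parts1: "\<And>x. x \<in> K \<Longrightarrow>
      (\<integral>y. W1 y * kernel_deriv r b (y - x) \<partial>lborel) = - (\<integral>y. H1 y * kernel r (y - x) \<partial>lborel)"
    and parts2: "\<And>x. x \<in> K \<Longrightarrow>
      (\<integral>y. W2 y * kernel_deriv r b (y - x) \<partial>lborel) = - (\<integral>y. H2 y * kernel r (y - x) \<partial>lborel)"
  defines "u \<equiv> \<lambda>x. (mollify r W2 x + e) / (mollify r W1 x + e)"
  shows "(\<integral>x. \<phi>' x * u x \<partial>lborel) + (\<integral>x. mollify r H2 x * (\<phi> x / (mollify r W1 x + e)) \<partial>lborel)
    - (\<integral>x. mollify r H1 x * (\<phi> x * u x / (mollify r W1 x + e)) \<partial>lborel) = 0"
proof -
  let ?w1 = "mollify r W1" and ?w2 = "mollify r W2"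
  have [measurable]: "W1 \<in> borel_measurable borel" "W2 \<in> borel_measurable borel"
    "H1 \<in> borel_measurable borel" "H2 \<in> borel_measurable borel"
    "\<phi> \<in> borel_measurable borel" "\<phi>' \<in> borel_measurable borel"
    using int phi by (auto intro: borel_measurable_continuous_onI)
  have [measurable]: "u \<in> borel_measurable borel" unfolding u_def by measurable
  have z: "mollify r (\<lambda>x. 0) x = 0" for x :: 'a by (simp add: mollify_def)
  have w1: "0 \<le> ?w1 x" for x
    using mollify_mono[OF \<open>r > 0\<close> _ int(1) sgn(1), where x=x] z by simp
  have w2: "0 \<le> ?w2 x" for x
    using mollify_mono[OF \<open>r > 0\<close> _ int(2) sgn(2), where x=x] z by simp
  have w12: "?w2 x \<le> C * ?w1 x" for x
    using mollify_mono[OF \<open>r > 0\<close> int(2) _ sgn(3)] int(1) by (simp add: mollify_cmult)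
  have u_bound: "\<bar>u x\<bar> \<le> C + 1" for x
    unfolding u_def by (rule regularized_quotient_le) (use w1 w2 w12 assms in auto)
  have inv_bound: "\<bar>1 / (?w1 x + e)\<bar> \<le> 1 / e" for x
    using w1[of x] \<open>e > 0\<close> by (simp add: divide_simps)
  obtain B1 where B1: "B1 \<ge> 0" "\<And>x. \<bar>\<phi> x\<bar> \<le> B1"
    using continuous_compact_support_bounded[OF phi(1) K(1,2)] by blast
  obtain B2 where B2: "B2 \<ge> 0" "\<And>x. \<bar>\<phi>' x\<bar> \<le> B2"
    using continuous_compact_support_bounded[OF phi(2) K(1,3)] by blast
  have phi_int: "integrable lborel \<phi>" "integrable lborel \<phi>'"
    by (rule integrable_lborel_bounded_compact_support[of _ B1 K] integrable_lborel_bounded_compact_support[of _ B2 K],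
        use B1 B2 K in auto)+
  \<comment> \<open>\<open>D1\<close> and \<open>D2\<close> are the classical derivatives of the
    mollified functions at every point; they are known to agree with the mollified \<open>H1\<close>
    and \<open>H2\<close> on \<open>K\<close> only.\<close>
  define D1 where "D1 x = - (\<integral>y. W1 y * kernel_deriv r b (y - x) \<partial>lborel)" for x
  define D2 where "D2 x = - (\<integral>y. W2 y * kernel_deriv r b (y - x) \<partial>lborel)" for x
  have [measurable]: "D1 \<in> borel_measurable borel" "D2 \<in> borel_measurable borel"
    unfolding D1_def[abs_def] D2_def[abs_def] by measurable
  obtain M1 where M1: "\<And>x. \<bar>D1 x\<bar> \<le> M1"
    using integral_mult_kernel_deriv_bounded[OF \<open>r > 0\<close> int(1), of b] unfolding D1_def by auto
  obtain M2 where M2: "\<And>x. \<bar>D2 x\<bar> \<le> M2"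
    using integral_mult_kernel_deriv_bounded[OF \<open>r > 0\<close> int(2), of b] unfolding D2_def by auto
  define d where "d x = \<phi>' x * u x + D2 x * (\<phi> x * (1 / (?w1 x + e))) - D1 x * (\<phi> x * u x * (1 / (?w1 x + e)))" for x
  have "(\<integral>x. d x \<partial>lborel) = 0"
  proof (rule integral_directional_derivative_eq_0[where f="\<lambda>x. \<phi> x * u x" and K=K])
    show "integrable lborel (\<lambda>x. \<phi> x * u x)"
      using phi_int u_bound by (intro integrable_mult_bounded[where B="C + 1"]) auto
    show "d \<in> borel_measurable borel" unfolding d_def[abs_def] by measurable
    show "((\<lambda>t. \<phi> (x + t *\<^sub>R b) * u (x + t *\<^sub>R b)) has_real_derivative d x) (at 0)" for x
    proof -
      have d1: "((\<lambda>t. ?w1 (x + t *\<^sub>R b)) has_real_derivative D1 x) (at 0)"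
        unfolding D1_def by (rule has_real_derivative_mollify) fact+
      have d2: "((\<lambda>t. ?w2 (x + t *\<^sub>R b)) has_real_derivative D2 x) (at 0)"
        unfolding D2_def by (rule has_real_derivative_mollify) fact+
      have nz: "?w1 x + e \<noteq> 0" using w1[of x] \<open>e > 0\<close> by linarith
      \<comment> \<open>Rearranges the quotient rule so that each derivative stands apart from a
        bounded coefficient.\<close>
      have alg: "p + (m * a - c * l) / (a * a) * f = p + m * (f * (1 / a)) - l * (f * (c / a) * (1 / a))"
        if "a \<noteq> 0" for p m l f a c :: real
        using that by (simp add: divide_simps) (simp add: algebra_simps)
      have "((\<lambda>t. \<phi> (x + t *\<^sub>R b) * u (x + t *\<^sub>R b)) has_real_derivative
          \<phi>' x * u x + (D2 x * (?w1 x + e) - (?w2 x + e) * D1 x) / ((?w1 x + e) * (?w1 x + e)) * \<phi> x) (at 0)"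
        unfolding u_def
        using DERIV_mult[OF phi(3)[of x] DERIV_divide[OF DERIV_add[OF d2 DERIV_const[of e]] DERIV_add[OF d1 DERIV_const[of e]]]] nz
        by simp
      then show ?thesis
        unfolding alg[OF nz] d_def u_def .
    qed
    show "\<bar>d x\<bar> \<le> B2 * (C + 1) + M2 * (B1 * (1 / e)) + M1 * (B1 * (C + 1) * (1 / e))" for x
    proof -
      have "0 \<le> M1" "0 \<le> M2"
        using M1[of x] M2[of x] by linarith+
      have tri: "\<bar>p + q - s\<bar> \<le> \<bar>p\<bar> + \<bar>q\<bar> + \<bar>s\<bar>" for p q s :: real
        by linarith
      have "\<bar>d x\<bar> \<le> \<bar>\<phi>' x\<bar> * \<bar>u x\<bar> + \<bar>D2 x\<bar> * (\<bar>\<phi> x\<bar> * \<bar>1 / (?w1 x + e)\<bar>)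
          + \<bar>D1 x\<bar> * (\<bar>\<phi> x\<bar> * \<bar>u x\<bar> * \<bar>1 / (?w1 x + e)\<bar>)"
        unfolding d_def abs_mult[symmetric] by (rule tri)
      also have "\<dots> \<le> B2 * (C + 1) + M2 * (B1 * (1 / e)) + M1 * (B1 * (C + 1) * (1 / e))"
        by (intro add_mono mult_mono mult_nonneg_nonneg)
          (use B1 B2 M1 M2 u_bound inv_bound \<open>0 \<le> M1\<close> \<open>0 \<le> M2\<close> \<open>C \<ge> 0\<close> \<open>e > 0\<close> in auto)
      finally show ?thesis .
    qed
    show "compact K" by fact
    show "d x = 0" if "x \<notin> K" for x using K that by (simp add: d_def)
  qed
  moreover have "d x = \<phi>' x * u x + mollify r H2 x * (\<phi> x / (?w1 x + e)) - mollify r H1 x * (\<phi> x * u x / (?w1 x + e))" for x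
  proof (cases "x \<in> K")
    case True
    then have "D1 x = mollify r H1 x" "D2 x = mollify r H2 x"
      using parts1 parts2 by (simp_all add: D1_def D2_def mollify_def)
    then show ?thesis by (simp add: d_def)
  qed (simp add: d_def K)
  moreover have "integrable lborel (\<lambda>x. \<phi>' x * u x)"
    using phi_int u_bound by (intro integrable_mult_bounded[where B="C + 1"]) auto
  moreover have "integrable lborel (\<lambda>x. mollify r H2 x * (\<phi> x / (?w1 x + e)))"
  proof (rule integrable_mult_bounded[where B="B1 * (1 / e)"])
    fix x
    have "\<bar>\<phi> x\<bar> * \<bar>1 / (?w1 x + e)\<bar> \<le> B1 * (1 / e)"
      using B1 inv_bound by (intro mult_mono) auto
    then show "\<bar>\<phi> x / (?w1 x + e)\<bar> \<le> B1 * (1 / e)" by (simp add: abs_mult)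
  qed (use integrable_mollify[OF \<open>r > 0\<close> int(4)] in auto)
  moreover have "integrable lborel (\<lambda>x. mollify r H1 x * (\<phi> x * u x / (?w1 x + e)))"
  proof (rule integrable_mult_bounded[where B="B1 * (C + 1) * (1 / e)"])
    fix x
    have "\<bar>\<phi> x\<bar> * \<bar>u x\<bar> * \<bar>1 / (?w1 x + e)\<bar> \<le> B1 * (C + 1) * (1 / e)"
      using B1 inv_bound u_bound \<open>C \<ge> 0\<close> by (intro mult_mono) auto
    then show "\<bar>\<phi> x * u x / (?w1 x + e)\<bar> \<le> B1 * (C + 1) * (1 / e)" by (simp add: abs_mult)
  qed (use integrable_mollify[OF \<open>r > 0\<close> int(3)] in auto)
  ultimately show ?thesis by simp
qed

text \<open>Limit of the kernel radius with \<open>e\<close> fixed: each integral pairs an L1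
  convergent factor with coefficients that are bounded, thanks to \<open>e\<close>, and converge
  almost everywhere.\<close>

lemma integral_regularized_quotient:
  fixes W1 W2 H1 H2 :: "'a::euclidean_space \<Rightarrow> real"
  assumes int: "integrable lborel W1" "integrable lborel W2" "integrable lborel H1" "integrable lborel H2"
    and sgn: "AE x in lborel. 0 \<le> W1 x" "AE x in lborel. 0 \<le> W2 x" "AE x in lborel. W2 x \<le> C * W1 x"
    and "C \<ge> 0" "e > 0" "\<delta> > 0"
    and phi: "continuous_on UNIV \<phi>" "continuous_on UNIV \<phi>'"
      "\<And>x. ((\<lambda>t. \<phi> (x + t *\<^sub>R b)) has_real_derivative \<phi>' x) (at 0)"
    and K: "compact K" "\<And>x. x \<notin> K \<Longrightarrow> \<phi> x = 0" "\<And>x. x \<notin> K \<Longrightarrow> \<phi>' x = 0"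
    and parts1: "\<And>r x. 0 < r \<Longrightarrow> r \<le> \<delta> \<Longrightarrow> x \<in> K \<Longrightarrow>
      (\<integral>y. W1 y * kernel_deriv r b (y - x) \<partial>lborel) = - (\<integral>y. H1 y * kernel r (y - x) \<partial>lborel)"
    and parts2: "\<And>r x. 0 < r \<Longrightarrow> r \<le> \<delta> \<Longrightarrow> x \<in> K \<Longrightarrow>
      (\<integral>y. W2 y * kernel_deriv r b (y - x) \<partial>lborel) = - (\<integral>y. H2 y * kernel r (y - x) \<partial>lborel)"
  defines "U \<equiv> \<lambda>x. (W2 x + e) / (W1 x + e)"
  shows "(\<integral>x. \<phi>' x * U x \<partial>lborel) + (\<integral>x. H2 x * (\<phi> x / (W1 x + e)) \<partial>lborel)
    - (\<integral>x. H1 x * (\<phi> x * U x / (W1 x + e)) \<partial>lborel) = 0"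
proof -
  define s where "s n = \<delta> / real (Suc n)" for n
  have s: "s n > 0" "s n \<le> \<delta>" for n
    using \<open>\<delta> > 0\<close> by (auto simp: s_def divide_simps)
  have s0: "s \<longlonglongrightarrow> 0"
    unfolding s_def[abs_def] using tendsto_mult_right[OF LIMSEQ_inverse_real_of_nat, of \<delta>]
    by (simp add: divide_inverse mult.commute)
  \<comment> \<open>L1 convergence gives convergence almost everywhere only along a subsequence; two
    nested extractions serve \<open>W1\<close> and \<open>W2\<close> together. For \<open>H1\<close>
    and \<open>H2\<close> L1 convergence suffices.\<close>
  obtain k1 where k1: "strict_mono k1" "AE x in lborel. (\<lambda>n. mollify (s (k1 n)) W1 x - W1 x) \<longlonglongrightarrow> 0"
    using tendsto_L1_AE_subseq[of lborel "\<lambda>n x. mollify (s n) W1 x - W1 x"]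
      mollify_tendsto_L1[OF int(1) s(1) s0] integrable_mollify[OF s(1) int(1)] int(1) by auto
  have sk0: "(\<lambda>n. s (k1 n)) \<longlonglongrightarrow> 0"
    using LIMSEQ_subseq_LIMSEQ[OF s0 k1(1)] by (simp add: comp_def)
  obtain k2 where k2: "strict_mono k2" "AE x in lborel. (\<lambda>n. mollify (s (k1 (k2 n))) W2 x - W2 x) \<longlonglongrightarrow> 0"
    using tendsto_L1_AE_subseq[of lborel "\<lambda>n x. mollify (s (k1 n)) W2 x - W2 x"]
      mollify_tendsto_L1[OF int(2) s(1) sk0] integrable_mollify[OF s(1) int(2)] int(2) by auto
  define r where "r n = s (k1 (k2 n))" for n
  have r: "r n > 0" "r n \<le> \<delta>" for n using s by (auto simp: r_def)
  have r0: "r \<longlonglongrightarrow> 0"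
    using LIMSEQ_subseq_LIMSEQ[OF sk0 k2(1)] by (simp add: comp_def r_def[abs_def])
  have conv1: "AE x in lborel. (\<lambda>n. mollify (r n) W1 x) \<longlonglongrightarrow> W1 x"
    using k1(2)
  proof eventually_elim
    case (elim x)
    then have "(\<lambda>n. mollify (r n) W1 x - W1 x) \<longlonglongrightarrow> 0"
      using LIMSEQ_subseq_LIMSEQ[OF elim k2(1)] by (simp add: comp_def r_def)
    then show ?case by (rule LIM_zero_cancel)
  qed
  have conv2: "AE x in lborel. (\<lambda>n. mollify (r n) W2 x) \<longlonglongrightarrow> W2 x"
    using k2(2) by eventually_elim (auto simp: r_def intro: LIM_zero_cancel)
  have [measurable]: "W1 \<in> borel_measurable borel" "W2 \<in> borel_measurable borel"
    "H1 \<in> borel_measurable borel" "H2 \<in> borel_measurable borel"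
    "\<phi> \<in> borel_measurable borel" "\<phi>' \<in> borel_measurable borel"
    using int phi by (auto intro: borel_measurable_continuous_onI)
  have [measurable]: "U \<in> borel_measurable borel" unfolding U_def by measurable
  define u where "u n x = (mollify (r n) W2 x + e) / (mollify (r n) W1 x + e)" for n x
  have [measurable]: "u n \<in> borel_measurable borel" for n unfolding u_def[abs_def] by measurable
  have z: "mollify \<rho> (\<lambda>x. 0) x = 0" for \<rho> and x :: 'a by (simp add: mollify_def)
  have w1: "0 \<le> mollify (r n) W1 x" for n x
    using mollify_mono[OF r(1) _ int(1) sgn(1), where x=x] z by simp
  have w2: "0 \<le> mollify (r n) W2 x" for n x
    using mollify_mono[OF r(1) _ int(2) sgn(2), where x=x] z by simp
  have w12: "mollify (r n) W2 x \<le> C * mollify (r n) W1 x" for n x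
    using mollify_mono[OF r(1) int(2) _ sgn(3)] int(1) by (simp add: mollify_cmult)
  have u_bound: "\<bar>u n x\<bar> \<le> C + 1" for n x
    unfolding u_def by (rule regularized_quotient_le) (use w1 w2 w12 assms in auto)
  have inv_bound: "\<bar>1 / (mollify (r n) W1 x + e)\<bar> \<le> 1 / e" for n x
    using w1[of n x] \<open>e > 0\<close> by (simp add: divide_simps)
  obtain B1 where B1: "B1 \<ge> 0" "\<And>x. \<bar>\<phi> x\<bar> \<le> B1"
    using continuous_compact_support_bounded[OF phi(1) K(1,2)] by blast
  obtain B2 where B2: "B2 \<ge> 0" "\<And>x. \<bar>\<phi>' x\<bar> \<le> B2"
    using continuous_compact_support_bounded[OF phi(2) K(1,3)] by blast
  have phi'_int: "integrable lborel \<phi>'"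
    by (rule integrable_lborel_bounded_compact_support[of _ B2 K]) (use B2 K in auto)
  have conv_inv: "AE x in lborel. (\<lambda>n. \<phi> x / (mollify (r n) W1 x + e)) \<longlonglongrightarrow> \<phi> x / (W1 x + e)"
    using conv1 sgn(1) by eventually_elim (use \<open>e > 0\<close> in \<open>auto intro!: tendsto_intros\<close>)
  have conv_u: "AE x in lborel. (\<lambda>n. u n x) \<longlonglongrightarrow> U x"
    using conv1 conv2 sgn(1) unfolding u_def U_def
    by eventually_elim (use \<open>e > 0\<close> in \<open>auto intro!: tendsto_intros\<close>)
  have conv_u_inv: "AE x in lborel. (\<lambda>n. \<phi> x * u n x / (mollify (r n) W1 x + e)) \<longlonglongrightarrow> \<phi> x * U x / (W1 x + e)"
    using conv1 conv_u sgn(1) by eventually_elim (use \<open>e > 0\<close> in \<open>auto intro!: tendsto_intros\<close>)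
  have 1: "(\<lambda>n. \<integral>x. \<phi>' x * u n x \<partial>lborel) \<longlonglongrightarrow> (\<integral>x. \<phi>' x * U x \<partial>lborel)"
    by (rule tendsto_integral_mult[where B="C + 1"]) (use phi'_int u_bound conv_u in auto)
  have 2: "(\<lambda>n. \<integral>x. mollify (r n) H2 x * (\<phi> x / (mollify (r n) W1 x + e)) \<partial>lborel) \<longlonglongrightarrow>
      (\<integral>x. H2 x * (\<phi> x / (W1 x + e)) \<partial>lborel)"
  proof (rule tendsto_integral_mult[where B="B1 * (1 / e)"])
    fix n x
    have "\<bar>\<phi> x\<bar> * \<bar>1 / (mollify (r n) W1 x + e)\<bar> \<le> B1 * (1 / e)"
      using B1 inv_bound by (intro mult_mono) auto
    then show "\<bar>\<phi> x / (mollify (r n) W1 x + e)\<bar> \<le> B1 * (1 / e)" by (simp add: abs_mult)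
  qed (use int integrable_mollify[OF r(1)] mollify_tendsto_L1[OF _ r(1) r0] conv_inv in auto)
  have 3: "(\<lambda>n. \<integral>x. mollify (r n) H1 x * (\<phi> x * u n x / (mollify (r n) W1 x + e)) \<partial>lborel) \<longlonglongrightarrow>
      (\<integral>x. H1 x * (\<phi> x * U x / (W1 x + e)) \<partial>lborel)"
  proof (rule tendsto_integral_mult[where B="B1 * (C + 1) * (1 / e)"])
    fix n x
    have "\<bar>\<phi> x\<bar> * \<bar>u n x\<bar> * \<bar>1 / (mollify (r n) W1 x + e)\<bar> \<le> B1 * (C + 1) * (1 / e)"
      using B1 inv_bound u_bound \<open>C \<ge> 0\<close> by (intro mult_mono) auto
    then show "\<bar>\<phi> x * u n x / (mollify (r n) W1 x + e)\<bar> \<le> B1 * (C + 1) * (1 / e)" by (simp add: abs_mult)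
  qed (use int integrable_mollify[OF r(1)] mollify_tendsto_L1[OF _ r(1) r0] conv_u_inv in auto)
  have "(\<integral>x. \<phi>' x * u n x \<partial>lborel) + (\<integral>x. mollify (r n) H2 x * (\<phi> x / (mollify (r n) W1 x + e)) \<partial>lborel)
    - (\<integral>x. mollify (r n) H1 x * (\<phi> x * u n x / (mollify (r n) W1 x + e)) \<partial>lborel) = 0" for n
    unfolding u_def
    by (rule integral_regularized_mollified_quotient[OF int sgn \<open>C \<ge> 0\<close> \<open>e > 0\<close> r(1) phi K])
      (use parts1 parts2 r in auto)
  with tendsto_diff[OF tendsto_add[OF 1 2] 3] show ?thesis
    by (simp add: LIMSEQ_const_iff)
qed

text \<open>Convergence and bound form one almost everywhere condition, and integrability is
  returned along with the limit because the limit integrals are split afterwards.\<close>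

lemma dominated_convergence:
  fixes s :: "nat \<Rightarrow> 'a \<Rightarrow> real"
  assumes "integrable M w" "f \<in> borel_measurable M" "\<And>n. s n \<in> borel_measurable M"
    and "AE x in M. (\<lambda>n. s n x) \<longlonglongrightarrow> f x \<and> (\<forall>n. \<bar>s n x\<bar> \<le> w x)"
  shows "integrable M f \<and> (\<forall>n. integrable M (s n)) \<and> (\<lambda>n. integral\<^sup>L M (s n)) \<longlonglongrightarrow> integral\<^sup>L M f"
proof -
  have 1: "AE x in M. (\<lambda>n. s n x) \<longlonglongrightarrow> f x" and 2: "\<And>n. AE x in M. norm (s n x) \<le> w x"
    by (rule eventually_mono[OF assms(4)], simp)+
  show ?thesis
    using integrable_dominated_convergence[OF assms(2,3,1) 1 2]
      integrable_dominated_convergence2[OF assms(2,3,1) 1 2]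
      integral_dominated_convergence[OF assms(2,3,1) 1 2] by blast
qed

text \<open>Limit of \<open>e\<close> to 0. Here \<open>log_int\<close> supplies the majorants.
  Positivity is needed on \<open>K\<close> only, as each integrand carries a factor
  \<open>\<phi>\<close> or \<open>\<phi>'\<close>.\<close>

lemma integral_quotient_by_parts:
  fixes W1 W2 H1 H2 :: "'a::euclidean_space \<Rightarrow> real"
  assumes int: "integrable lborel W1" "integrable lborel W2" "integrable lborel H1" "integrable lborel H2"
    and sgn: "AE x in lborel. 0 \<le> W1 x" "AE x in lborel. 0 \<le> W2 x" "AE x in lborel. W2 x \<le> C * W1 x"
    and pos: "AE x in lborel. x \<in> K \<longrightarrow> 0 < W1 x \<and> 0 < W2 x"
    and log_int: "integrable lborel (\<lambda>x. H1 x / W1 x)" "integrable lborel (\<lambda>x. H2 x / W2 x)"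
    and "C \<ge> 0" "\<delta> > 0"
    and phi: "continuous_on UNIV \<phi>" "continuous_on UNIV \<phi>'"
      "\<And>x. ((\<lambda>t. \<phi> (x + t *\<^sub>R b)) has_real_derivative \<phi>' x) (at 0)"
    and K: "compact K" "\<And>x. x \<notin> K \<Longrightarrow> \<phi> x = 0" "\<And>x. x \<notin> K \<Longrightarrow> \<phi>' x = 0"
    and parts1: "\<And>r x. 0 < r \<Longrightarrow> r \<le> \<delta> \<Longrightarrow> x \<in> K \<Longrightarrow>
      (\<integral>y. W1 y * kernel_deriv r b (y - x) \<partial>lborel) = - (\<integral>y. H1 y * kernel r (y - x) \<partial>lborel)"
    and parts2: "\<And>r x. 0 < r \<Longrightarrow> r \<le> \<delta> \<Longrightarrow> x \<in> K \<Longrightarrow>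
      (\<integral>y. W2 y * kernel_deriv r b (y - x) \<partial>lborel) = - (\<integral>y. H2 y * kernel r (y - x) \<partial>lborel)"
  shows "(\<integral>x. W2 x / W1 x * \<phi>' x \<partial>lborel) =
    - (\<integral>x. W2 x / W1 x * (H2 x / W2 x - H1 x / W1 x) * \<phi> x \<partial>lborel)"
proof -
  define e where "e n = inverse (real (Suc n))" for n
  have e: "e n > 0" for n by (simp add: e_def)
  have e0: "e \<longlonglongrightarrow> 0" unfolding e_def[abs_def] by (rule LIMSEQ_inverse_real_of_nat)
  have [measurable]: "W1 \<in> borel_measurable borel" "W2 \<in> borel_measurable borel"
    "H1 \<in> borel_measurable borel" "H2 \<in> borel_measurable borel"
    "\<phi> \<in> borel_measurable borel" "\<phi>' \<in> borel_measurable borel"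
    using int phi by (auto intro: borel_measurable_continuous_onI)
  obtain B1 where B1: "B1 \<ge> 0" "\<And>x. \<bar>\<phi> x\<bar> \<le> B1"
    using continuous_compact_support_bounded[OF phi(1) K(1,2)] by blast
  obtain B2 where B2: "B2 \<ge> 0" "\<And>x. \<bar>\<phi>' x\<bar> \<le> B2"
    using continuous_compact_support_bounded[OF phi(2) K(1,3)] by blast
  have phi'_int: "integrable lborel \<phi>'"
    by (rule integrable_lborel_bounded_compact_support[of _ B2 K]) (use B2 K in auto)
  define U where "U n x = (W2 x + e n) / (W1 x + e n)" for n x
  have [measurable]: "U n \<in> borel_measurable borel" for n unfolding U_def[abs_def] by measurable
  have U_bound: "AE x in lborel. \<forall>n. \<bar>U n x\<bar> \<le> C + 1"
    using sgn unfolding U_def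
    by eventually_elim (intro allI regularized_quotient_le e \<open>C \<ge> 0\<close>)
  have U_lim: "(\<lambda>n. U n x) \<longlonglongrightarrow> W2 x / W1 x" if "W1 x > 0" for x
    unfolding U_def using that e0 tendsto_add[OF tendsto_const e0]
    by (intro tendsto_divide) (force intro: tendsto_eq_intros)+
  have inv_lim: "(\<lambda>n. c / (W1 x + e n)) \<longlonglongrightarrow> c / W1 x" if "W1 x > 0" for x c
    using that e0 tendsto_add[OF tendsto_const e0]
    by (intro tendsto_divide) (force intro: tendsto_eq_intros)+
  have inv_le: "\<bar>c / (W1 x + e n)\<bar> \<le> \<bar>c / W1 x\<bar>" if "W1 x > 0" for x c n
    using that e[of n] by (auto simp: abs_mult divide_simps intro!: mult_left_mono)
  have 1: "integrable lborel (\<lambda>x. \<phi>' x * (W2 x / W1 x)) \<and> (\<forall>n. integrable lborel (\<lambda>x. \<phi>' x * U n x)) \<and>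
    (\<lambda>n. \<integral>x. \<phi>' x * U n x \<partial>lborel) \<longlonglongrightarrow> (\<integral>x. \<phi>' x * (W2 x / W1 x) \<partial>lborel)"
  proof (rule dominated_convergence[where w="\<lambda>x. \<bar>\<phi>' x\<bar> * (C + 1)"])
    show "AE x in lborel. (\<lambda>n. \<phi>' x * U n x) \<longlonglongrightarrow> \<phi>' x * (W2 x / W1 x) \<and>
        (\<forall>n. \<bar>\<phi>' x * U n x\<bar> \<le> \<bar>\<phi>' x\<bar> * (C + 1))"
      using pos U_bound
    proof eventually_elim
      case (elim x)
      then show ?case
        using tendsto_mult_left[OF U_lim, of x "\<phi>' x"]
        by (cases "x \<in> K") (auto simp: K abs_mult intro!: mult_left_mono)
    qed
  qed (use phi'_int in auto)
  have 2: "integrable lborel (\<lambda>x. H2 x / W1 x * \<phi> x) \<and> (\<forall>n. integrable lborel (\<lambda>x. H2 x * (\<phi> x / (W1 x + e n)))) \<and>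
    (\<lambda>n. \<integral>x. H2 x * (\<phi> x / (W1 x + e n)) \<partial>lborel) \<longlonglongrightarrow> (\<integral>x. H2 x / W1 x * \<phi> x \<partial>lborel)"
  \<comment> \<open>Only H2 / W2 is known to be integrable, not H2 / W1; the bound W2 \<le> C * W1
    exchanges the denominators at the cost of the factor \<open>C\<close>.\<close>
  proof (rule dominated_convergence[where w="\<lambda>x. \<bar>H2 x / W2 x\<bar> * (C * B1)"])
    show "AE x in lborel. (\<lambda>n. H2 x * (\<phi> x / (W1 x + e n))) \<longlonglongrightarrow> H2 x / W1 x * \<phi> x \<and>
        (\<forall>n. \<bar>H2 x * (\<phi> x / (W1 x + e n))\<bar> \<le> \<bar>H2 x / W2 x\<bar> * (C * B1))"
      using pos sgn(3)
    proof eventually_elim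
      case (elim x)
      show ?case
      proof (cases "x \<in> K")
        case True
        then have p: "W1 x > 0" "W2 x > 0" using elim by auto
        have "\<bar>H2 x * (\<phi> x / (W1 x + e n))\<bar> \<le> \<bar>H2 x / W2 x\<bar> * (C * B1)" for n
        proof -
          have "\<bar>H2 x * (\<phi> x / (W1 x + e n))\<bar> = \<bar>H2 x / (W1 x + e n)\<bar> * \<bar>\<phi> x\<bar>"
            by (simp add: abs_mult)
          also have "\<dots> \<le> \<bar>H2 x / W1 x\<bar> * B1"
            using B1 by (intro mult_mono inv_le p) auto
          also have "\<bar>H2 x / W1 x\<bar> = \<bar>H2 x / W2 x\<bar> * (W2 x / W1 x)"
            using p by (simp add: abs_mult)
          also have "\<dots> \<le> \<bar>H2 x / W2 x\<bar> * C"
            using p elim by (intro mult_left_mono) (auto simp: pos_divide_le_eq)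
          finally show ?thesis using B1(1) by (simp add: mult_right_mono mult.assoc)
        qed
        moreover have "(\<lambda>n. H2 x * (\<phi> x / (W1 x + e n))) \<longlonglongrightarrow> H2 x / W1 x * \<phi> x"
          using tendsto_mult_right[OF inv_lim[OF p(1), of "H2 x"], of "\<phi> x"] by (simp add: mult.commute)
        ultimately show ?thesis by blast
      qed (use \<open>C \<ge> 0\<close> B1 in \<open>simp add: K\<close>)
    qed
    show "integrable lborel (\<lambda>x. \<bar>H2 x / W2 x\<bar> * (C * B1))"
      by (intro integrable_mult_left integrable_abs log_int)
  qed auto
  have 3: "integrable lborel (\<lambda>x. H1 x / W1 x * (\<phi> x * (W2 x / W1 x))) \<and>
      (\<forall>n. integrable lborel (\<lambda>x. H1 x * (\<phi> x * U n x / (W1 x + e n)))) \<and>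
    (\<lambda>n. \<integral>x. H1 x * (\<phi> x * U n x / (W1 x + e n)) \<partial>lborel) \<longlonglongrightarrow> (\<integral>x. H1 x / W1 x * (\<phi> x * (W2 x / W1 x)) \<partial>lborel)"
  proof (rule dominated_convergence[where w="\<lambda>x. \<bar>H1 x / W1 x\<bar> * (B1 * (C + 1))"])
    show "AE x in lborel. (\<lambda>n. H1 x * (\<phi> x * U n x / (W1 x + e n))) \<longlonglongrightarrow> H1 x / W1 x * (\<phi> x * (W2 x / W1 x)) \<and>
        (\<forall>n. \<bar>H1 x * (\<phi> x * U n x / (W1 x + e n))\<bar> \<le> \<bar>H1 x / W1 x\<bar> * (B1 * (C + 1)))"
      using pos U_bound
    proof eventually_elim
      case (elim x)
      show ?case
      proof (cases "x \<in> K")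
        case True
        then have p: "W1 x > 0" using elim by auto
        have "\<bar>H1 x * (\<phi> x * U n x / (W1 x + e n))\<bar> \<le> \<bar>H1 x / W1 x\<bar> * (B1 * (C + 1))" for n
        proof -
          have "\<bar>H1 x * (\<phi> x * U n x / (W1 x + e n))\<bar> = \<bar>H1 x / (W1 x + e n)\<bar> * (\<bar>\<phi> x\<bar> * \<bar>U n x\<bar>)"
            by (simp add: abs_mult)
          also have "\<dots> \<le> \<bar>H1 x / W1 x\<bar> * (B1 * (C + 1))"
            using B1 elim \<open>C \<ge> 0\<close> by (intro mult_mono inv_le p) auto
          finally show ?thesis .
        qed
        moreover have "(\<lambda>n. H1 x * (\<phi> x * U n x / (W1 x + e n))) \<longlonglongrightarrow> H1 x / W1 x * (\<phi> x * (W2 x / W1 x))"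
          using tendsto_mult[OF inv_lim[OF p(1), of "H1 x"] tendsto_mult_left[OF U_lim[OF p], of "\<phi> x"]] by simp
        ultimately show ?thesis by blast
      qed (use \<open>C \<ge> 0\<close> B1 in \<open>simp add: K\<close>)
    qed
    show "integrable lborel (\<lambda>x. \<bar>H1 x / W1 x\<bar> * (B1 * (C + 1)))"
      by (intro integrable_mult_left integrable_abs log_int)
  qed auto
  have "(\<integral>x. \<phi>' x * U n x \<partial>lborel) + (\<integral>x. H2 x * (\<phi> x / (W1 x + e n)) \<partial>lborel)
    - (\<integral>x. H1 x * (\<phi> x * U n x / (W1 x + e n)) \<partial>lborel) = 0" for n
    unfolding U_def
    by (rule integral_regularized_quotient[OF int sgn \<open>C \<ge> 0\<close> e \<open>\<delta> > 0\<close> phi K])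
      (use parts1 parts2 in auto)
  then have *: "(\<integral>x. \<phi>' x * (W2 x / W1 x) \<partial>lborel) + (\<integral>x. H2 x / W1 x * \<phi> x \<partial>lborel)
      - (\<integral>x. H1 x / W1 x * (\<phi> x * (W2 x / W1 x)) \<partial>lborel) = 0"
    using tendsto_diff[OF tendsto_add[OF 1[THEN conjunct2, THEN conjunct2] 2[THEN conjunct2, THEN conjunct2]]
      3[THEN conjunct2, THEN conjunct2]]
    by (simp add: LIMSEQ_const_iff)
  \<comment> \<open>On \<open>K\<close> the factor W2 is nonzero and cancels; off \<open>K\<close>
    both sides vanish with \<open>\<phi>\<close>.\<close>
  have "(\<integral>x. W2 x / W1 x * (H2 x / W2 x - H1 x / W1 x) * \<phi> x \<partial>lborel) =
    (\<integral>x. H2 x / W1 x * \<phi> x - H1 x / W1 x * (\<phi> x * (W2 x / W1 x)) \<partial>lborel)"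
  proof (rule integral_cong_AE)
    show "AE x in lborel. W2 x / W1 x * (H2 x / W2 x - H1 x / W1 x) * \<phi> x =
        H2 x / W1 x * \<phi> x - H1 x / W1 x * (\<phi> x * (W2 x / W1 x))"
      using pos
    proof eventually_elim
      case (elim x)
      then show ?case by (cases "x \<in> K") (auto simp: K field_simps)
    qed
  qed auto
  also have "\<dots> = (\<integral>x. H2 x / W1 x * \<phi> x \<partial>lborel) - (\<integral>x. H1 x / W1 x * (\<phi> x * (W2 x / W1 x)) \<partial>lborel)"
    using 2 3 by (intro Bochner_Integration.integral_diff) auto
  finally show ?thesis
    using * by (simp add: mult.commute)
qed

section \<open>Weak gradients\<close>

lemma L1_loc_D: "f \<in> L1_loc \<Omega> \<Longrightarrow> compact K \<Longrightarrow> K \<subseteq> \<Omega> \<Longrightarrow> set_integrable lebesgue K f"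
  by (simp add: L1_loc_def)

lemma L1_loc_inner: "g \<in> L1_loc \<Omega> \<Longrightarrow> (\<lambda>x. g x \<bullet> b) \<in> L1_loc \<Omega>"
  unfolding L1_loc_def set_integrable_def
proof (clarify)
  fix K
  assume "\<forall>K. compact K \<and> K \<subseteq> \<Omega> \<longrightarrow> integrable lebesgue (\<lambda>x. indicat_real K x *\<^sub>R g x)"
    "compact K" "K \<subseteq> \<Omega>"
  then have "integrable lebesgue (\<lambda>x. (indicat_real K x *\<^sub>R g x) \<bullet> b)"
    by (intro integrable_inner_left) simp
  then show "integrable lebesgue (\<lambda>x. indicat_real K x *\<^sub>R (g x \<bullet> b))"
    by simp
qed

text \<open>Passage from \<open>lebesgue\<close> to \<open>lborel\<close>, where the translation and
  convolution arguments take place: the function is cut off outside \<open>K\<close> and made Borel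
  by a change on a null set.\<close>

lemma borel_representative:
  fixes f :: "'a::euclidean_space \<Rightarrow> real"
  assumes "set_integrable lebesgue K f"
  obtains F where "integrable lborel F" "AE x in lborel. F x = indicator K x * f x"
proof -
  have i: "integrable lebesgue (\<lambda>x. indicator K x * f x)"
    using assms by (simp add: set_integrable_def)
  then obtain F where F [measurable]: "F \<in> borel_measurable lborel"
    and ae: "AE x in lborel. indicator K x * f x = F x"
    using completion_ex_borel_measurable_real[OF borel_measurable_integrable[OF i]] by auto
  have "integrable lebesgue F"
    using i by (rule integrable_cong_AE_imp) (use F ae in \<open>auto intro: AE_completion measurable_completion\<close>)
  then have "integrable lborel F"
    using integrable_completion[OF F] by simp
  then show ?thesis
    using ae by (intro that[of F]) (auto elim!: eventually_mono)
qed

lemma set_integral_mult_compact_support: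
  fixes f F \<psi> :: "'a::euclidean_space \<Rightarrow> real"
  assumes "K \<subseteq> \<Omega>" and [measurable]: "F \<in> borel_measurable borel" "\<psi> \<in> borel_measurable borel"
    and F: "AE x in lborel. F x = indicator K x * f x" and K: "\<And>x. x \<notin> K \<Longrightarrow> \<psi> x = 0"
  shows "(LINT x:\<Omega>|lebesgue. f x * \<psi> x) = (\<integral>x. F x * \<psi> x \<partial>lborel)"
proof -
  have m: "(\<lambda>x. F x * \<psi> x) \<in> borel_measurable lborel" by simp
  have ae: "AE x in lebesgue. F x * \<psi> x = indicator \<Omega> x *\<^sub>R (f x * \<psi> x)"
  proof (rule AE_completion)
    show "AE x in lborel. F x * \<psi> x = indicator \<Omega> x *\<^sub>R (f x * \<psi> x)"
      using F
    proof eventually_elim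
      case (elim x)
      then show ?case using K[of x] \<open>K \<subseteq> \<Omega>\<close> by (cases "x \<in> K") auto
    qed
  qed
  \<comment> \<open>Measurability of the integrand over \<open>\<Omega>\<close> comes from
    completeness: it equals a Borel function almost everywhere.\<close>
  have "(LINT x:\<Omega>|lebesgue. f x * \<psi> x) = (\<integral>x. F x * \<psi> x \<partial>lebesgue)"
    unfolding set_lebesgue_integral_def
    using ae measurable_completion[OF m] borel_measurable_AE[OF measurable_completion[OF m] ae]
    by (intro integral_cong_AE) (auto elim!: eventually_mono)
  also have "\<dots> = (\<integral>x. F x * \<psi> x \<partial>lborel)"
    using m by (rule integral_completion)
  finally show ?thesis .
qed

text \<open>\<open>K'\<close> is the sum of \<open>K\<close> and a closed ball, hence compact. It
  leaves room for kernels of radius at most \<open>\<delta>\<close> centred in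
  \<open>K\<close>.\<close>

lemma compact_neighbourhood:
  fixes \<Omega> :: "'a::euclidean_space set"
  assumes "open \<Omega>" "compact K" "K \<subseteq> \<Omega>"
  obtains \<delta> K' where "\<delta> > 0" "compact K'" "K \<subseteq> K'" "K' \<subseteq> \<Omega>" "\<And>x. x \<in> K \<Longrightarrow> cball x \<delta> \<subseteq> K'"
proof -
  obtain \<delta> where \<delta>: "\<delta> > 0" "(\<Union>x\<in>K. cball x \<delta>) \<subseteq> \<Omega>"
    using compact_subset_open_imp_cball_epsilon_subset[OF assms(2,1,3)] by blast
  have eq: "(\<Union>x\<in>K. cball x \<delta>) = {x + y |x y. x \<in> K \<and> y \<in> cball 0 \<delta>}"
  proof (intro equalityI subsetI)
    fix z assume "z \<in> (\<Union>x\<in>K. cball x \<delta>)"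
    then obtain x where "x \<in> K" "z \<in> cball x \<delta>" by blast
    then show "z \<in> {x + y |x y. x \<in> K \<and> y \<in> cball 0 \<delta>}"
      by (intro CollectI exI[of _ x] exI[of _ "z - x"]) (auto simp: dist_norm norm_minus_commute)
  next
    fix z assume "z \<in> {x + y |x y. x \<in> K \<and> y \<in> cball 0 \<delta>}"
    then obtain x y where "z = x + y" "x \<in> K" "y \<in> cball 0 \<delta>" by blast
    then show "z \<in> (\<Union>x\<in>K. cball x \<delta>)"
      by (intro UN_I[of x]) (auto simp: dist_norm)
  qed
  have "compact (\<Union>x\<in>K. cball x \<delta>)"
    unfolding eq by (intro compact_sums assms compact_cball)
  then show ?thesis
    using \<delta> by (intro that[of \<delta> "\<Union>x\<in>K. cball x \<delta>"]) auto
qed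

lemma frechet_derivative_kernel:
  "frechet_derivative (\<lambda>y. kernel r (y - x)) (at y) = (\<lambda>v. kernel_deriv r v (y - x))"
  by (rule frechet_derivative_at[symmetric]) (rule has_derivative_kernel)

lemma
  assumes "0 < r" "r \<le> \<delta>" "cball x \<delta> \<subseteq> K" "z \<notin> K"
  shows kernel_shift_outside: "kernel r (z - x) = 0"
    and kernel_deriv_shift_outside: "kernel_deriv r v (z - x) = 0"
proof -
  have "z \<notin> cball x \<delta>" using assms(3,4) by blast
  then have "z - x \<notin> ball 0 r" using assms(2) by (simp add: dist_norm norm_minus_commute)
  then show "kernel r (z - x) = 0" "kernel_deriv r v (z - x) = 0"
    using assms(1) by (auto intro: kernel_outside kernel_deriv_outside simp del: mem_ball)
qed

text \<open>The weak derivative tested with the kernel centred at x. Together with the sign in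
  \<open>has_real_derivative_mollify\<close> it says that at x the derivative of the mollified
  \<open>W\<close> is the mollified \<open>H\<close>.\<close>

lemma weak_gradient_kernel:
  fixes w W H :: "'a::euclidean_space \<Rightarrow> real"
  assumes "has_weak_gradient \<Omega> w g" "b \<in> Basis" "K' \<subseteq> \<Omega>" "0 < r" "r \<le> \<delta>" "cball x \<delta> \<subseteq> K'"
    and [measurable]: "W \<in> borel_measurable borel" "H \<in> borel_measurable borel"
    and W: "AE x in lborel. W x = indicator K' x * w x"
    and H: "AE x in lborel. H x = indicator K' x * (g x \<bullet> b)"
  shows "(\<integral>y. W y * kernel_deriv r b (y - x) \<partial>lborel) = - (\<integral>y. H y * kernel r (y - x) \<partial>lborel)"
proof -
  have "cball x r \<subseteq> \<Omega>"
    using assms by (meson order_trans subset_cball)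
  from assms(1)[unfolded has_weak_gradient_def, THEN conjunct2, THEN conjunct2, rule_format,
      OF kernel_in_test_functions[OF assms(4) this] assms(2)]
  have "(LINT y:\<Omega>|lebesgue. w y * kernel_deriv r b (y - x)) =
      - (LINT y:\<Omega>|lebesgue. (g y \<bullet> b) * kernel r (y - x))"
    by (simp only: frechet_derivative_kernel)
  moreover have "(LINT y:\<Omega>|lebesgue. w y * kernel_deriv r b (y - x)) =
      (\<integral>y. W y * kernel_deriv r b (y - x) \<partial>lborel)"
    by (intro set_integral_mult_compact_support[OF assms(3) _ _ W] kernel_deriv_shift_outside[OF assms(4-6)]) simp_all
  moreover have "(LINT y:\<Omega>|lebesgue. (g y \<bullet> b) * kernel r (y - x)) =
      (\<integral>y. H y * kernel r (y - x) \<partial>lborel)"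
    by (intro set_integral_mult_compact_support[OF assms(3) _ _ H] kernel_shift_outside[OF assms(4-6)]) simp_all
  ultimately show ?thesis by simp
qed

section \<open>Uniqueness of the weak gradient\<close>

text \<open>The fundamental lemma of the calculus of variations: mollifications with small radius
  vanish on a given compact set, yet converge to f in L1; countably many compact sets exhaust
  \<open>\<Omega>\<close>.\<close>

lemma AE_zero_if_orthogonal_to_test_functions:
  fixes f :: "'a::euclidean_space \<Rightarrow> real"
  assumes "open \<Omega>" "f \<in> L1_loc \<Omega>"
    and zero: "\<And>\<phi>. \<phi> \<in> test_functions \<Omega> \<Longrightarrow> (LINT x:\<Omega>|lebesgue. f x * \<phi> x) = 0"
  shows "AE x\<in>\<Omega> in lebesgue. f x = 0"
proof -
  have local: "AE x in lborel. x \<in> K \<longrightarrow> f x = 0" if K: "compact K" "K \<subseteq> \<Omega>" for K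
  proof -
    obtain \<delta> K' where \<delta>: "\<delta> > 0" "compact K'" "K \<subseteq> K'" "K' \<subseteq> \<Omega>" "\<And>x. x \<in> K \<Longrightarrow> cball x \<delta> \<subseteq> K'"
      using compact_neighbourhood[OF \<open>open \<Omega>\<close> K] by metis
    obtain F where F: "integrable lborel F" "AE x in lborel. F x = indicator K' x * f x"
      using borel_representative[OF L1_loc_D[OF assms(2) \<delta>(2,4)]] by blast
    have [measurable]: "F \<in> borel_measurable borel" "K \<in> sets borel"
      using F(1) K(1) by (auto simp: compact_imp_closed)
    have m0: "mollify r F x = 0" if "0 < r" "r \<le> \<delta>" "x \<in> K" for r x
    proof -
      have "cball x r \<subseteq> \<Omega>"
        using that \<delta> by (meson order_trans subset_cball)
      then have "(LINT y:\<Omega>|lebesgue. f y * kernel r (y - x)) = 0"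
        using that by (intro zero kernel_in_test_functions)
      moreover have "(LINT y:\<Omega>|lebesgue. f y * kernel r (y - x)) = mollify r F x"
        unfolding mollify_def
        by (intro set_integral_mult_compact_support[OF \<delta>(4) _ _ F(2)]
            kernel_shift_outside[OF that(1,2) \<delta>(5)[OF that(3)]]) simp_all
      ultimately show ?thesis by simp
    qed
    define s where "s n = \<delta> / real (Suc n)" for n
    have s: "s n > 0" "s n \<le> \<delta>" for n
      using \<open>\<delta> > 0\<close> by (auto simp: s_def divide_simps)
    have s0: "s \<longlonglongrightarrow> 0"
      unfolding s_def[abs_def] using tendsto_mult_right[OF LIMSEQ_inverse_real_of_nat, of \<delta>]
      by (simp add: divide_inverse mult.commute)
    have iK: "integrable lborel (\<lambda>x. \<bar>F x\<bar> * indicat_real K x)"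
      using F(1) by (intro integrable_mult_bounded[where B=1]) auto
    \<comment> \<open>On \<open>K\<close> the mollification is 0, so there \<bar>F\<bar> is the
      mollification error itself.\<close>
    have "(\<integral>x. \<bar>F x\<bar> * indicat_real K x \<partial>lborel) \<le> (\<integral>x. \<bar>mollify (s n) F x - F x\<bar> \<partial>lborel)" for n
      using F(1) iK integrable_mollify[OF s(1) F(1)] m0[OF s]
      by (intro integral_mono) (auto split: split_indicator)
    then have "(\<integral>x. \<bar>F x\<bar> * indicat_real K x \<partial>lborel) \<le> 0"
      by (intro LIMSEQ_le_const[OF mollify_tendsto_L1[OF F(1) s(1) s0]]) auto
    moreover have "(\<integral>x. \<bar>F x\<bar> * indicat_real K x \<partial>lborel) \<ge> 0"
      by (intro integral_nonneg_AE) auto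
    ultimately have "AE x in lborel. \<bar>F x\<bar> * indicat_real K x = 0"
      using integral_nonneg_eq_0_iff_AE[OF iK] by auto
    then show ?thesis
      using F(2) by eventually_elim (use \<delta>(3) in auto)
  qed
  obtain C where C: "\<And>n::nat. compact (C n)" "\<And>n. C n \<subseteq> \<Omega>" "\<Union> (range C) = \<Omega>"
    using open_Union_compact_subsets[OF \<open>open \<Omega>\<close>] by metis
  have "AE x in lborel. \<forall>n. x \<in> C n \<longrightarrow> f x = 0"
    unfolding AE_all_countable using local C(1,2) by blast
  then have "AE x\<in>\<Omega> in lborel. f x = 0"
    by eventually_elim (use C(3) in blast)
  then show ?thesis by (rule AE_completion)
qed

text \<open>Each component of the difference is orthogonal to all test functions. The integral of
  the difference is split through Borel representatives on the support of the test function, where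
  integrability is available.\<close>

lemma weak_gradient_unique:
  fixes g h :: "'a::euclidean_space \<Rightarrow> 'a"
  assumes "open \<Omega>" "has_weak_gradient \<Omega> u g" "has_weak_gradient \<Omega> u h"
  shows "AE x\<in>\<Omega> in lebesgue. g x = h x"
proof -
  have L1: "(\<lambda>x. g x \<bullet> b) \<in> L1_loc \<Omega>" "(\<lambda>x. h x \<bullet> b) \<in> L1_loc \<Omega>" for b
    using assms by (auto simp: has_weak_gradient_def intro: L1_loc_inner)
  have "AE x\<in>\<Omega> in lebesgue. g x \<bullet> b - h x \<bullet> b = 0" if b: "b \<in> Basis" for b
  proof (rule AE_zero_if_orthogonal_to_test_functions[OF \<open>open \<Omega>\<close>])
    show "(\<lambda>x. g x \<bullet> b - h x \<bullet> b) \<in> L1_loc \<Omega>"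
      using L1[of b] by (auto simp: L1_loc_def intro!: set_integral_diff)
    fix \<phi> assume \<phi>: "\<phi> \<in> test_functions \<Omega>"
    define K where "K = closure {x. \<phi> x \<noteq> 0}"
    have K: "compact K" "K \<subseteq> \<Omega>" "\<And>x. x \<notin> K \<Longrightarrow> \<phi> x = 0"
      using \<phi> closure_subset[of "{x. \<phi> x \<noteq> 0}"] by (auto simp: test_functions_def K_def)
    have "Ck 0 \<phi>" using \<phi> by (simp only: test_functions_def mem_Collect_eq)
    then have cont: "continuous_on UNIV \<phi>" by simp
    then have [measurable]: "\<phi> \<in> borel_measurable borel" by (rule borel_measurable_continuous_onI)
    obtain B where B: "\<And>x. \<bar>\<phi> x\<bar> \<le> B"
      using continuous_compact_support_bounded[OF cont K(1,3)] by blast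
    obtain G where G: "integrable lborel G" "AE x in lborel. G x = indicator K x * (g x \<bullet> b)"
      using borel_representative[OF L1_loc_D[OF L1(1) K(1,2)]] by blast
    obtain H where H: "integrable lborel H" "AE x in lborel. H x = indicator K x * (h x \<bullet> b)"
      using borel_representative[OF L1_loc_D[OF L1(2) K(1,2)]] by blast
    have [measurable]: "G \<in> borel_measurable borel" "H \<in> borel_measurable borel"
      using G H by auto
    have "AE x in lborel. G x - H x = indicator K x * (g x \<bullet> b - h x \<bullet> b)"
      using G(2) H(2) by eventually_elim (simp add: right_diff_distrib)
    then have "(LINT x:\<Omega>|lebesgue. (g x \<bullet> b - h x \<bullet> b) * \<phi> x) = (\<integral>x. (G x - H x) * \<phi> x \<partial>lborel)"
      using K by (intro set_integral_mult_compact_support) auto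
    also have "\<dots> = (\<integral>x. G x * \<phi> x \<partial>lborel) - (\<integral>x. H x * \<phi> x \<partial>lborel)"
      unfolding left_diff_distrib
      using B by (intro Bochner_Integration.integral_diff integrable_mult_bounded[where B=B] G H) auto
    also have "(\<integral>x. G x * \<phi> x \<partial>lborel) = (LINT x:\<Omega>|lebesgue. (g x \<bullet> b) * \<phi> x)"
      using K by (intro set_integral_mult_compact_support[OF _ _ _ G(2), symmetric]) auto
    also have "(\<integral>x. H x * \<phi> x \<partial>lborel) = (LINT x:\<Omega>|lebesgue. (h x \<bullet> b) * \<phi> x)"
      using K by (intro set_integral_mult_compact_support[OF _ _ _ H(2), symmetric]) auto
    also have "(LINT x:\<Omega>|lebesgue. (g x \<bullet> b) * \<phi> x) - (LINT x:\<Omega>|lebesgue. (h x \<bullet> b) * \<phi> x) = 0"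
      using assms(2,3) \<phi> b unfolding has_weak_gradient_def by force
    finally show "(LINT x:\<Omega>|lebesgue. (g x \<bullet> b - h x \<bullet> b) * \<phi> x) = 0" .
  qed
  \<comment> \<open>The basis is finite, so the exceptional null sets can be united.\<close>
  then have "AE x in lebesgue. \<forall>b\<in>Basis. x \<in> \<Omega> \<longrightarrow> g x \<bullet> b - h x \<bullet> b = 0"
    by (intro AE_finite_allI) auto
  then show ?thesis
    by eventually_elim (auto intro: euclidean_eqI)
qed

text \<open>Supplies the one-variable form used above. The derivative vanishes off the closed
  support because \<open>\<phi>\<close> is 0 on its open complement.\<close>

lemma test_function_directional_derivative:
  fixes \<phi> :: "'a::euclidean_space \<Rightarrow> real"
  assumes \<phi>: "\<phi> \<in> test_functions \<Omega>"
  shows "continuous_on UNIV \<phi>"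
    and "continuous_on UNIV (\<lambda>x. frechet_derivative \<phi> (at x) b)"
    and "((\<lambda>t. \<phi> (x + t *\<^sub>R b)) has_real_derivative frechet_derivative \<phi> (at x) b) (at 0)"
    and "x \<notin> closure {x. \<phi> x \<noteq> 0} \<Longrightarrow> frechet_derivative \<phi> (at x) b = 0"
proof -
  have Ck: "Ck k \<phi>" for k using \<phi> by (simp only: test_functions_def mem_Collect_eq)
  show "continuous_on UNIV \<phi>" using Ck[of 0] by simp
  show "continuous_on UNIV (\<lambda>x. frechet_derivative \<phi> (at x) b)" using Ck[of "Suc 0"] by simp
  have D: "(\<phi> has_derivative frechet_derivative \<phi> (at x)) (at x)"
    using Ck[of "Suc 0"] by (simp add: frechet_derivative_works)
  have "((\<lambda>t. x + t *\<^sub>R b) has_derivative (\<lambda>h. h *\<^sub>R b)) (at 0)"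
    by (auto intro!: derivative_eq_intros)
  moreover have "(\<phi> has_derivative frechet_derivative \<phi> (at x)) (at (x + 0 *\<^sub>R b))"
    using D by simp
  ultimately have "((\<lambda>t. \<phi> (x + t *\<^sub>R b)) has_derivative (\<lambda>h. frechet_derivative \<phi> (at x) (h *\<^sub>R b))) (at 0)"
    by (rule has_derivative_compose)
  then show "((\<lambda>t. \<phi> (x + t *\<^sub>R b)) has_real_derivative frechet_derivative \<phi> (at x) b) (at 0)"
    unfolding has_field_derivative_def
    by (rule has_derivative_eq_rhs)
      (simp add: fun_eq_iff linear_scale[OF has_derivative_linear[OF D]] mult.commute)
  show "frechet_derivative \<phi> (at x) b = 0" if "x \<notin> closure {x. \<phi> x \<noteq> 0}"
  proof -
    have "(\<phi> has_derivative (\<lambda>h. 0)) (at x)"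
    proof (rule has_derivative_transform_within_open)
      show "((\<lambda>x. 0) has_derivative (\<lambda>h. 0)) (at x)" by simp
      show "open (- closure {x. \<phi> x \<noteq> 0})" by (intro open_Compl closed_closure)
      show "0 = \<phi> y" if "y \<in> - closure {x. \<phi> x \<noteq> 0}" for y
        using that closure_subset[of "{x. \<phi> x \<noteq> 0}"] by auto
    qed (use that in simp)
    then show ?thesis by (simp add: frechet_derivative_at[symmetric])
  qed
qed

lemma L1_loc_mult_L_infinity:
  fixes u :: "'a::euclidean_space \<Rightarrow> real" and g :: "'a \<Rightarrow> 'b::euclidean_space"
  assumes u: "u \<in> L_infinity \<Omega>" and g: "g \<in> L1_loc \<Omega>"
  shows "(\<lambda>x. u x *\<^sub>R g x) \<in> L1_loc \<Omega>"
  unfolding L1_loc_def set_integrable_def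
proof (clarify)
  fix K assume K: "compact K" "K \<subseteq> \<Omega>"
  have [measurable]: "K \<in> sets lebesgue" using K(1) by (simp add: lmeasurable_compact fmeasurableD)
  obtain C where C: "AE x\<in>\<Omega> in lebesgue. \<bar>u x\<bar> \<le> C" using u by (auto simp: L_infinity_def)
  have g': "integrable lebesgue (\<lambda>x. indicat_real K x *\<^sub>R g x)"
    using L1_loc_D[OF g K] by (simp add: set_integrable_def)
  \<comment> \<open>Measurability of \<open>u\<close> is known on \<open>\<Omega>\<close> only; as
    \<open>K\<close> lies in \<open>\<Omega>\<close>, inserting the indicator of
    \<open>\<Omega>\<close> changes nothing on \<open>K\<close>.\<close>
  have "(\<lambda>x. indicat_real \<Omega> x *\<^sub>R u x) \<in> borel_measurable lebesgue"
    using u by (simp add: L_infinity_def set_borel_measurable_def)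
  then have "(\<lambda>x. (indicat_real \<Omega> x *\<^sub>R u x) *\<^sub>R (indicat_real K x *\<^sub>R g x)) \<in> borel_measurable lebesgue"
    using borel_measurable_integrable[OF g'] by (rule borel_measurable_scaleR)
  also have "(\<lambda>x. (indicat_real \<Omega> x *\<^sub>R u x) *\<^sub>R (indicat_real K x *\<^sub>R g x)) = (\<lambda>x. indicat_real K x *\<^sub>R (u x *\<^sub>R g x))"
    using K(2) by (auto simp: fun_eq_iff split: split_indicator)
  finally have m: "(\<lambda>x. indicat_real K x *\<^sub>R (u x *\<^sub>R g x)) \<in> borel_measurable lebesgue" .
  show "integrable lebesgue (\<lambda>x. indicat_real K x *\<^sub>R (u x *\<^sub>R g x))"
  proof (rule Bochner_Integration.integrable_bound[OF integrable_scaleR_right[OF g', of C] m])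
    show "AE x in lebesgue. norm (indicat_real K x *\<^sub>R (u x *\<^sub>R g x)) \<le> norm (C *\<^sub>R (indicat_real K x *\<^sub>R g x))"
      using C
    proof eventually_elim
      case (elim x)
      then show ?case
        using K(2) by (auto split: split_indicator intro!: mult_right_mono)
    qed
  qed
qed

text \<open>Stated for one quotient under a bound on that quotient, so that exchanging the two
  functions yields the reciprocal.\<close>

lemma has_weak_gradient_quotient:
  fixes w1 w2 :: "'a::euclidean_space \<Rightarrow> real" and g1 g2 :: "'a \<Rightarrow> 'a"
  assumes "open \<Omega>"
    and grad: "has_weak_gradient \<Omega> w1 g1" "has_weak_gradient \<Omega> w2 g2"
    and pos: "AE x\<in>\<Omega> in lebesgue. w1 x > 0" "AE x\<in>\<Omega> in lebesgue. w2 x > 0"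
    and bdd: "(\<lambda>x. w2 x / w1 x) \<in> L_infinity \<Omega>"
    and log: "(\<lambda>x. g1 x /\<^sub>R w1 x) \<in> L1_loc \<Omega>" "(\<lambda>x. g2 x /\<^sub>R w2 x) \<in> L1_loc \<Omega>"
  shows "has_weak_gradient \<Omega> (\<lambda>x. w2 x / w1 x)
    (\<lambda>x. (w2 x / w1 x) *\<^sub>R (g2 x /\<^sub>R w2 x - g1 x /\<^sub>R w1 x))"
    (is "has_weak_gradient \<Omega> ?u ?h")
proof -
  \<comment> \<open>A bounded measurable function is locally integrable, being its product with the
    constant 1.\<close>
  have "(\<lambda>x. 1::real) \<in> L1_loc \<Omega>"
    unfolding L1_loc_def
    by (auto simp: set_integrable_def fmeasurable_def dest!: lmeasurable_compact intro!: integrable_real_indicator)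
  from L1_loc_mult_L_infinity[OF bdd this] have u: "?u \<in> L1_loc \<Omega>" by simp
  have "(\<lambda>x. g2 x /\<^sub>R w2 x - g1 x /\<^sub>R w1 x) \<in> L1_loc \<Omega>"
    using log by (auto simp: L1_loc_def intro!: set_integral_diff)
  from L1_loc_mult_L_infinity[OF bdd this] have h: "?h \<in> L1_loc \<Omega>" .
  have w: "w1 \<in> L1_loc \<Omega>" "w2 \<in> L1_loc \<Omega>" "g1 \<in> L1_loc \<Omega>" "g2 \<in> L1_loc \<Omega>"
    using grad by (auto simp: has_weak_gradient_def)
  obtain C0 where "AE x\<in>\<Omega> in lebesgue. \<bar>?u x\<bar> \<le> C0" using bdd by (auto simp: L_infinity_def)
  then have AE_\<Omega>: "AE x in lborel. x \<in> \<Omega> \<longrightarrow> w1 x > 0 \<and> w2 x > 0 \<and> w2 x / w1 x \<le> C0"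
    using pos unfolding AE_completion_iff by eventually_elim auto
  \<comment> \<open>The almost everywhere bound \<open>C0\<close> has no known sign, while the
    estimates ask for a nonnegative constant.\<close>
  define C where "C = max C0 0"
  have "(LINT x:\<Omega>|lebesgue. ?u x * frechet_derivative \<phi> (at x) b) = - (LINT x:\<Omega>|lebesgue. (?h x \<bullet> b) * \<phi> x)"
    if \<phi>: "\<phi> \<in> test_functions \<Omega>" and b: "b \<in> Basis" for \<phi> b
  proof -
    define K where "K = closure {x. \<phi> x \<noteq> 0}"
    have K: "compact K" "K \<subseteq> \<Omega>" "\<And>x. x \<notin> K \<Longrightarrow> \<phi> x = 0"
      using \<phi> closure_subset[of "{x. \<phi> x \<noteq> 0}"] by (auto simp: test_functions_def K_def)
    note \<phi>' = test_function_directional_derivative(1)[OF \<phi>]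
      test_function_directional_derivative(2-4)[OF \<phi>, where b=b, folded K_def]
    have [measurable]: "\<phi> \<in> borel_measurable borel" "(\<lambda>x. frechet_derivative \<phi> (at x) b) \<in> borel_measurable borel"
      using \<phi>'(1,2) by (auto intro: borel_measurable_continuous_onI)
    \<comment> \<open>Representatives are cut at \<open>K'\<close> rather than at \<open>K\<close>,
      so that kernels centred in \<open>K\<close> meet the original functions.\<close>
    obtain \<delta> K' where \<delta>: "\<delta> > 0" "compact K'" "K \<subseteq> K'" "K' \<subseteq> \<Omega>" "\<And>x. x \<in> K \<Longrightarrow> cball x \<delta> \<subseteq> K'"
      using compact_neighbourhood[OF \<open>open \<Omega>\<close> K(1,2)] by metis
    note rep = borel_representative[OF L1_loc_D[OF _ \<delta>(2,4)]]
    obtain W1 where W1: "integrable lborel W1" "AE x in lborel. W1 x = indicator K' x * w1 x"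
      using rep[OF w(1)] by blast
    obtain W2 where W2: "integrable lborel W2" "AE x in lborel. W2 x = indicator K' x * w2 x"
      using rep[OF w(2)] by blast
    obtain H1 where H1: "integrable lborel H1" "AE x in lborel. H1 x = indicator K' x * (g1 x \<bullet> b)"
      using rep[OF L1_loc_inner[OF w(3)]] by blast
    obtain H2 where H2: "integrable lborel H2" "AE x in lborel. H2 x = indicator K' x * (g2 x \<bullet> b)"
      using rep[OF L1_loc_inner[OF w(4)]] by blast
    obtain G1 where G1: "integrable lborel G1" "AE x in lborel. G1 x = indicator K' x * ((g1 x /\<^sub>R w1 x) \<bullet> b)"
      using rep[OF L1_loc_inner[OF log(1)]] by blast
    obtain G2 where G2: "integrable lborel G2" "AE x in lborel. G2 x = indicator K' x * ((g2 x /\<^sub>R w2 x) \<bullet> b)"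
      using rep[OF L1_loc_inner[OF log(2)]] by blast
    have [measurable]: "W1 \<in> borel_measurable borel" "W2 \<in> borel_measurable borel"
      "H1 \<in> borel_measurable borel" "H2 \<in> borel_measurable borel"
      using W1 W2 H1 H2 by auto
    have sgn: "AE x in lborel. 0 \<le> W1 x" "AE x in lborel. 0 \<le> W2 x"
      using AE_\<Omega> W1(2) W2(2) by (eventually_elim, use \<delta>(4) in \<open>auto split: split_indicator\<close>)+
    have le: "AE x in lborel. W2 x \<le> C * W1 x"
      using AE_\<Omega> W1(2) W2(2)
    proof eventually_elim
      case (elim x)
      show ?case
      proof (cases "x \<in> K'")
        case True
        then have "w1 x > 0" "w2 x / w1 x \<le> C" using elim(1) \<delta>(4) by (auto simp: C_def)
        then show ?thesis using True elim by (simp add: pos_divide_le_eq)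
      qed (use elim in simp)
    qed
    have posK: "AE x in lborel. x \<in> K \<longrightarrow> 0 < W1 x \<and> 0 < W2 x"
      using AE_\<Omega> W1(2) W2(2)
    proof eventually_elim
      case (elim x)
      then show ?case using \<delta>(3,4) by auto
    qed
    \<comment> \<open>Off \<open>K'\<close> the quotient is 0 / 0, which is 0 and thus agrees with
      the cut-off representative \<open>G1\<close>.\<close>
    have log1: "integrable lborel (\<lambda>x. H1 x / W1 x)"
    proof (rule integrable_cong_AE_imp[OF G1(1)])
      show "AE x in lborel. G1 x = H1 x / W1 x"
        using G1(2) H1(2) W1(2)
        by eventually_elim (auto simp: divide_inverse mult.commute split: split_indicator)
    qed simp
    have log2: "integrable lborel (\<lambda>x. H2 x / W2 x)"
    proof (rule integrable_cong_AE_imp[OF G2(1)])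
      show "AE x in lborel. G2 x = H2 x / W2 x"
        using G2(2) H2(2) W2(2)
        by eventually_elim (auto simp: divide_inverse mult.commute split: split_indicator)
    qed simp
    have "(LINT x:\<Omega>|lebesgue. ?u x * frechet_derivative \<phi> (at x) b) =
        (\<integral>x. W2 x / W1 x * frechet_derivative \<phi> (at x) b \<partial>lborel)"
    proof (rule set_integral_mult_compact_support[OF \<delta>(4)])
      show "AE x in lborel. W2 x / W1 x = indicator K' x * (w2 x / w1 x)"
        using W1(2) W2(2) by eventually_elim (auto split: split_indicator)
      show "frechet_derivative \<phi> (at x) b = 0" if "x \<notin> K'" for x
        using that \<delta>(3) \<phi>'(4) by blast
    qed auto
    also have "\<dots> = - (\<integral>x. W2 x / W1 x * (H2 x / W2 x - H1 x / W1 x) * \<phi> x \<partial>lborel)"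
    proof (rule integral_quotient_by_parts[OF W1(1) W2(1) H1(1) H2(1) sgn le posK log1 log2 _ \<delta>(1) \<phi>'(1,2,3) K(1,3) \<phi>'(4)])
      show "C \<ge> 0" by (simp add: C_def)
      show "(\<integral>y. W1 y * kernel_deriv r b (y - x) \<partial>lborel) = - (\<integral>y. H1 y * kernel r (y - x) \<partial>lborel)"
        "(\<integral>y. W2 y * kernel_deriv r b (y - x) \<partial>lborel) = - (\<integral>y. H2 y * kernel r (y - x) \<partial>lborel)"
        if "0 < r" "r \<le> \<delta>" "x \<in> K" for r x
        using weak_gradient_kernel[OF grad(1) b \<delta>(4) that(1,2) \<delta>(5)[OF that(3)] _ _ W1(2) H1(2)]
          weak_gradient_kernel[OF grad(2) b \<delta>(4) that(1,2) \<delta>(5)[OF that(3)] _ _ W2(2) H2(2)] by simp_all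
    qed
    also have "(\<integral>x. W2 x / W1 x * (H2 x / W2 x - H1 x / W1 x) * \<phi> x \<partial>lborel) =
        (LINT x:\<Omega>|lebesgue. (?h x \<bullet> b) * \<phi> x)"
    proof (rule set_integral_mult_compact_support[OF \<delta>(4), symmetric])
      show "AE x in lborel. W2 x / W1 x * (H2 x / W2 x - H1 x / W1 x) = indicator K' x * (?h x \<bullet> b)"
        using W1(2) W2(2) H1(2) H2(2)
        by eventually_elim (auto simp: inner_diff_left divide_inverse mult.commute split: split_indicator)
      show "\<phi> x = 0" if "x \<notin> K'" for x using that \<delta>(3) K(3) by blast
    qed auto
    finally show ?thesis .
  qed
  then show ?thesis
    using u h unfolding has_weak_gradient_def by blast
qed

theorem lemma5p1:
  fixes \<Omega> :: "'a::euclidean_space set"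
    and p w1 w2 :: "'a \<Rightarrow> real"
    and g1 g2 :: "'a \<Rightarrow> 'a"
  assumes "DIM('a) \<ge> 2"
    and "open \<Omega>" and "bounded \<Omega>" and "connected \<Omega>" and "\<Omega> \<noteq> {}"
    and "admissible_exponent \<Omega> p"
    and "w1 \<in> W1p_var \<Omega> p" and "w2 \<in> W1p_var \<Omega> p"
    and "has_weak_gradient \<Omega> w1 g1" and "has_weak_gradient \<Omega> w2 g2"
    and "AE x\<in>\<Omega> in lebesgue. w1 x > 0" and "AE x\<in>\<Omega> in lebesgue. w2 x > 0"
    and "(\<lambda>x. w1 x / w2 x) \<in> L_infinity \<Omega>" and "(\<lambda>x. w2 x / w1 x) \<in> L_infinity \<Omega>"
    and "(\<lambda>x. g1 x /\<^sub>R w1 x) \<in> L1_loc \<Omega>" and "(\<lambda>x. g2 x /\<^sub>R w2 x) \<in> L1_loc \<Omega>"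
  shows "(\<lambda>x. w2 x / w1 x) \<in> W11_loc \<Omega> \<and> (\<lambda>x. w1 x / w2 x) \<in> W11_loc \<Omega> \<and>
    (\<forall>h. has_weak_gradient \<Omega> (\<lambda>x. w2 x / w1 x) h \<longrightarrow>
       (AE x\<in>\<Omega> in lebesgue.
          h x = (w1 x *\<^sub>R g2 x - w2 x *\<^sub>R g1 x) /\<^sub>R (w1 x)\<^sup>2 \<and>
          (w1 x *\<^sub>R g2 x - w2 x *\<^sub>R g1 x) /\<^sub>R (w1 x)\<^sup>2 =
            (w2 x / w1 x) *\<^sub>R (g2 x /\<^sub>R w2 x - g1 x /\<^sub>R w1 x)))"
proof -
  note pos = assms(11,12)
  have w21: "has_weak_gradient \<Omega> (\<lambda>x. w2 x / w1 x)
    (\<lambda>x. (w2 x / w1 x) *\<^sub>R (g2 x /\<^sub>R w2 x - g1 x /\<^sub>R w1 x))"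
    using assms by (intro has_weak_gradient_quotient)
  have w12: "has_weak_gradient \<Omega> (\<lambda>x. w1 x / w2 x)
    (\<lambda>x. (w1 x / w2 x) *\<^sub>R (g1 x /\<^sub>R w1 x - g2 x /\<^sub>R w2 x))"
    using assms by (intro has_weak_gradient_quotient)
  \<comment> \<open>By uniqueness an arbitrary weak gradient \<open>h\<close> agrees with the one in
    \<open>w21\<close>; what remains is pointwise algebra where both functions are positive.\<close>
  have "AE x\<in>\<Omega> in lebesgue. h x = (w1 x *\<^sub>R g2 x - w2 x *\<^sub>R g1 x) /\<^sub>R (w1 x)\<^sup>2 \<and>
      (w1 x *\<^sub>R g2 x - w2 x *\<^sub>R g1 x) /\<^sub>R (w1 x)\<^sup>2 =
        (w2 x / w1 x) *\<^sub>R (g2 x /\<^sub>R w2 x - g1 x /\<^sub>R w1 x)"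
    if "has_weak_gradient \<Omega> (\<lambda>x. w2 x / w1 x) h" for h
    using weak_gradient_unique[OF \<open>open \<Omega>\<close> that w21] pos
  proof eventually_elim
    case (elim x)
    have "(w1 x *\<^sub>R g2 x - w2 x *\<^sub>R g1 x) /\<^sub>R (w1 x)\<^sup>2 =
        (w2 x / w1 x) *\<^sub>R (g2 x /\<^sub>R w2 x - g1 x /\<^sub>R w1 x)" if "x \<in> \<Omega>"
    proof -
      \<comment> \<open>The coefficients of \<open>g2 x\<close> and \<open>g1 x\<close> are compared
        separately, which reduces the vector identity to two scalar ones.\<close>
      have "inverse ((w1 x)\<^sup>2) * w1 x = w2 x / w1 x * inverse (w2 x)"
        "inverse ((w1 x)\<^sup>2) * w2 x = w2 x / w1 x * inverse (w1 x)"
        using elim that by (simp_all add: field_simps power2_eq_square)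
      then show ?thesis by (simp only: scaleR_diff_right scaleR_scaleR)
    qed
    with elim show ?case by simp
  qed
  with w21 w12 show ?thesis
    unfolding W11_loc_def by blast
qed

end
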